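(* Let $f\colon\Gamma\to G$ be a group homomorphism and let $p\colon\widetilde G\to G$ be a central $f$-extension. \begin{enumerate} \item Suppose that $H_2(G;\mathbb Z)/f_*H_2(\Gamma;\mathbb Z)$ is torsion-free. If $\widetilde G$ is left-orderable (respectively circularly orderable), then $G\wedge_fG$ is left-orderable (respectively circularly orderable). \item Suppose that $J_2(G)/(f\otimes f)(J_2(\Gamma))$ is torsion-free. If $\widetilde G$ is left-orderable (respectively circularly orderable), then $G\otimes_fG$ is left-orderable (respectively circularly orderable). \end{enumerate}
   Context: For $f\colon\Gamma\to G$, an $f$-extension of $G$ is an epimorphism $p\colon\widetilde G\to G$ for which there is a homomorphism $\widetilde f\colon\Gamma\to\widetilde G$ with $p\widetilde f=f$; it is central if $\ker p\subseteq Z(\widetilde G)$. With ${}^{x}y=xyx^{-1}$ and $[x,y]=xyx^{-1}y^{-1}$, the non-abelian tensor square $G\otimes G$ is the group generated by symbols $g\otimes h$ ($g,h\in G$) with relations $gg'\otimes h=({}^{g}g'\otimes{}^{g}h)(g\otimes h)$, $g\otimes hh'=(g\otimes h)({}^{h}g\otimes{}^{h}h')$. The exterior square $G\wedge G$ is its quotient by the normal closure of all $g\otimes g$. Put $J_2(G)=\ker(G\otimes G\to[G,G],\ g\otimes h\mapsto[g,h])$, which is central in $G\otimes G$. The kernel of $G\wedge G\to[G,G]$, $g\wedge h\mapsto[g,h]$, is central and naturally identified with $H_2(G;\mathbb Z)$; under this identification $f_*H_2(\Gamma;\mathbb Z)$ is the image under $f\wedge f$ of $\ker(\Gamma\wedge\Gamma\to[\Gamma,\Gamma])$.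 Put $G\otimes_fG=(G\otimes G)/(f\otimes f)(J_2(\Gamma))$ and $G\wedge_fG=(G\wedge G)/f_*H_2(\Gamma;\mathbb Z)$. A group is left-orderable if it admits a strict total order invariant under left multiplication. A group $G$ is circularly orderable if there is a map $c\colon G^3\to\{-1,0,1\}$ with $c(g_1,g_2,g_3)=0$ exactly when $g_1,g_2,g_3$ are not pairwise distinct, $c(g_2,g_3,g_4)-c(g_1,g_3,g_4)+c(g_1,g_2,g_4)-c(g_1,g_2,g_3)=0$ for all $g_i$, and $c(gg_1,gg_2,gg_3)=c(g_1,g_2,g_3)$ for all $g,g_i\in G$. *)

theory Defs
  imports "HOL-Algebra.Generated_Groups"
begin

section \<open>Groups given by generators and relations\<close>

text \<open>A letter \<open>(x, True)\<close> stands for the generator \<open>x\<close> and \<open>(x, False)\<close> for its inverse.\<close>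

type_synonym 'x word = "('x \<times> bool) list"

definition words :: "'x set \<Rightarrow> 'x word set" where
  "words X = lists (X \<times> UNIV)"

inductive pres_eq :: "'x set \<Rightarrow> ('x word \<times> 'x word) set \<Rightarrow> 'x word \<Rightarrow> 'x word \<Rightarrow> bool"
  for X R where
  pe_refl: "w \<in> words X \<Longrightarrow> pres_eq X R w w"
| pe_sym: "pres_eq X R u v \<Longrightarrow> pres_eq X R v u"
| pe_trans: "pres_eq X R u v \<Longrightarrow> pres_eq X R v w \<Longrightarrow> pres_eq X R u w"
| pe_append: "pres_eq X R u u' \<Longrightarrow> pres_eq X R v v' \<Longrightarrow> pres_eq X R (u @ v) (u' @ v')"
| pe_cancel: "x \<in> X \<Longrightarrow> pres_eq X R [(x, b), (x, \<not> b)] []"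
| pe_rel: "(u, v) \<in> R \<Longrightarrow> u \<in> words X \<Longrightarrow> v \<in> words X \<Longrightarrow> pres_eq X R u v"

definition pres_rel :: "'x set \<Rightarrow> ('x word \<times> 'x word) set \<Rightarrow> ('x word \<times> 'x word) set" where
  "pres_rel X R = {(u, v). pres_eq X R u v}"

definition presented_group :: "'x set \<Rightarrow> ('x word \<times> 'x word) set \<Rightarrow> 'x word set monoid" where
  "presented_group X R =
     \<lparr>carrier = words X // pres_rel X R,
      mult = (\<lambda>A B. \<Union>u\<in>A. \<Union>v\<in>B. pres_rel X R `` {u @ v}),
      one = pres_rel X R `` {[]}\<rparr>"

definition word_eval :: "('a, 'm) monoid_scheme \<Rightarrow> ('x \<Rightarrow> 'a) \<Rightarrow> 'x word \<Rightarrow> 'a" where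
  "word_eval H \<phi> w =
     foldr (\<lambda>(x, b) a. (if b then \<phi> x else inv\<^bsub>H\<^esub> (\<phi> x)) \<otimes>\<^bsub>H\<^esub> a) w \<one>\<^bsub>H\<^esub>"

text \<open>The map that a function \<open>h\<close> on representatives induces on classes (equivalence classes of
  words, or cosets); meaningful when \<open>h\<close> is constant on every class.\<close>

definition induced :: "('a \<Rightarrow> 'b) \<Rightarrow> 'a set \<Rightarrow> 'b" where
  "induced h C = the_elem (h ` C)"

lemma pres_eq_words: "pres_eq X R u v \<Longrightarrow> u \<in> words X \<and> v \<in> words X"
  by (induction rule: pres_eq.induct) (auto simp: words_def)

lemma equiv_pres_rel: "equiv (words X) (pres_rel X R)"
proof (rule equivI)
  show "pres_rel X R \<subseteq> words X \<times> words X"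
    using pres_eq_words by (fastforce simp: pres_rel_def)
  show "refl_on (words X) (pres_rel X R)"
    by (auto simp: refl_on_def pres_rel_def pe_refl)
  show "sym (pres_rel X R)"
    by (auto simp: sym_def pres_rel_def pe_sym)
  show "trans (pres_rel X R)"
    by (auto simp: trans_def pres_rel_def intro: pe_trans)
qed

lemma presented_mult:
  assumes "u \<in> words X" "v \<in> words X"
  shows "(pres_rel X R `` {u}) \<otimes>\<^bsub>presented_group X R\<^esub> (pres_rel X R `` {v})
         = pres_rel X R `` {u @ v}"
proof -
  let ?u = "pres_rel X R `` {u}" and ?v = "pres_rel X R `` {v}"
  have *: "pres_rel X R `` {u' @ v'} = pres_rel X R `` {u @ v}" if "u' \<in> ?u" "v' \<in> ?v" for u' v'
  proof (rule equiv_class_eq[OF equiv_pres_rel])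
    show "(u' @ v', u @ v) \<in> pres_rel X R"
      using that by (simp add: pres_rel_def pe_sym pe_append)
  qed
  have "u \<in> ?u" "v \<in> ?v" using assms by (simp_all add: pres_rel_def pe_refl)
  with * have "(\<Union>u'\<in>?u. \<Union>v'\<in>?v. pres_rel X R `` {u' @ v'}) = pres_rel X R `` {u @ v}"
    by blast
  then show ?thesis by (simp add: presented_group_def)
qed

lemma presented_carrierE:
  assumes "A \<in> carrier (presented_group X R)"
  obtains u where "u \<in> words X" "A = pres_rel X R `` {u}"
  using assms by (auto simp: presented_group_def quotient_def)

lemma presented_carrierI:
  "u \<in> words X \<Longrightarrow> pres_rel X R `` {u} \<in> carrier (presented_group X R)"
  by (auto simp: presented_group_def quotient_def)

lemma words_append: "u \<in> words X \<Longrightarrow> v \<in> words X \<Longrightarrow> u @ v \<in> words X"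
  by (auto simp: words_def)

lemma words_Nil: "[] \<in> words X"
  by (simp add: words_def)

lemma presented_one: "\<one>\<^bsub>presented_group X R\<^esub> = pres_rel X R `` {[]}"
  by (simp add: presented_group_def)

lemma pres_left_inverse:
  assumes "w \<in> words X"
  shows "\<exists>u \<in> words X. pres_eq X R (u @ w) []"
  using assms
proof (induction w)
  case Nil
  show ?case by (intro bexI[of _ "[]"]) (simp_all add: words_Nil pe_refl)
next
  case (Cons l w)
  obtain x b where l: "l = (x, b)" by force
  from Cons.prems have w: "w \<in> words X" and x: "x \<in> X" by (auto simp: words_def l)
  from Cons.IH[OF w] obtain u where u: "u \<in> words X" "pres_eq X R (u @ w) []" by blast
  have c: "pres_eq X R [(x, \<not> b), (x, b)] []" using pe_cancel[OF x, of R "\<not> b"] by simp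
  have "pres_eq X R (u @ [(x, \<not> b), (x, b)] @ w) (u @ [] @ w)"
    by (intro pe_append pe_refl c u w)
  then have "pres_eq X R ((u @ [(x, \<not> b)]) @ l # w) []"
    using pe_trans[OF _ u(2)] by (simp add: l)
  moreover have "u @ [(x, \<not> b)] \<in> words X" using u x by (auto simp: words_def)
  ultimately show ?case by blast
qed

lemma group_presented_group: "group (presented_group X R)"
proof (rule groupI)
  fix A assume "A \<in> carrier (presented_group X R)"
  then obtain u where u: "u \<in> words X" "A = pres_rel X R `` {u}" by (rule presented_carrierE)
  obtain v where v: "v \<in> words X" "pres_eq X R (v @ u) []"
    using pres_left_inverse[OF u(1)] by blast
  have "pres_rel X R `` {v @ u} = pres_rel X R `` {[]}"
    by (rule equiv_class_eq[OF equiv_pres_rel]) (simp add: pres_rel_def v)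
  then show "\<exists>B\<in>carrier (presented_group X R). B \<otimes>\<^bsub>presented_group X R\<^esub> A = \<one>\<^bsub>presented_group X R\<^esub>"
    using u v by (metis presented_carrierI presented_mult presented_one)
qed (auto elim!: presented_carrierE simp: presented_mult presented_one words_append words_Nil
      intro!: presented_carrierI)

lemma (in group) word_eval_closed:
  assumes "\<phi> \<in> X \<rightarrow> carrier G" "w \<in> words X"
  shows "word_eval G \<phi> w \<in> carrier G"
  using assms(2) by (induction w) (use assms(1) in \<open>auto simp: word_eval_def words_def Pi_iff\<close>)

lemma (in group) word_eval_append:
  assumes "\<phi> \<in> X \<rightarrow> carrier G" "u \<in> words X" "v \<in> words X"
  shows "word_eval G \<phi> (u @ v) = word_eval G \<phi> u \<otimes> word_eval G \<phi> v"
  using assms(2)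
proof (induction u)
  case Nil
  then show ?case using word_eval_closed[OF assms(1,3)] by (simp add: word_eval_def)
next
  case (Cons l u)
  obtain x b where l: "l = (x, b)" by force
  have u: "u \<in> words X" and x: "\<phi> x \<in> carrier G"
    using Cons.prems assms(1) by (auto simp: words_def l)
  have C: "word_eval G \<phi> ((x, b) # w) = (if b then \<phi> x else inv (\<phi> x)) \<otimes> word_eval G \<phi> w" for w
    by (simp add: word_eval_def)
  show ?case
    using Cons.IH[OF u] x word_eval_closed[OF assms(1) u] word_eval_closed[OF assms(1,3)]
    by (simp add: l C m_assoc)
qed

lemma (in group) word_eval_pres_eq:
  assumes "\<phi> \<in> X \<rightarrow> carrier G"
    and "\<And>u v. (u, v) \<in> R \<Longrightarrow> word_eval G \<phi> u = word_eval G \<phi> v"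
    and "pres_eq X R u v"
  shows "word_eval G \<phi> u = word_eval G \<phi> v"
  using assms(3)
proof (induction rule: pres_eq.induct)
  case (pe_append u u' v v')
  then show ?case using word_eval_append[OF assms(1)] pres_eq_words by metis
next
  case (pe_cancel x b)
  then show ?case using assms(1) by (cases b) (auto simp: word_eval_def Pi_iff)
qed (use assms(2) in auto)

lemma (in group) induced_word_eval:
  assumes "\<phi> \<in> X \<rightarrow> carrier G"
    and "\<And>u v. (u, v) \<in> R \<Longrightarrow> word_eval G \<phi> u = word_eval G \<phi> v"
    and "w \<in> words X"
  shows "induced (word_eval G \<phi>) (pres_rel X R `` {w}) = word_eval G \<phi> w"
proof -
  have "w \<in> pres_rel X R `` {w}" using pe_refl[OF assms(3)] by (simp add: pres_rel_def)
  moreover have "word_eval G \<phi> v = word_eval G \<phi> w" if "v \<in> pres_rel X R `` {w}" for v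
    using word_eval_pres_eq[OF assms(1,2), where v=v and u=w] that by (simp add: pres_rel_def)
  ultimately have "word_eval G \<phi> ` (pres_rel X R `` {w}) = {word_eval G \<phi> w}" by blast
  then show ?thesis by (simp add: induced_def)
qed

lemma (in group) induced_word_eval_hom:
  assumes "\<phi> \<in> X \<rightarrow> carrier G"
    and "\<And>u v. (u, v) \<in> R \<Longrightarrow> word_eval G \<phi> u = word_eval G \<phi> v"
  shows "induced (word_eval G \<phi>) \<in> hom (presented_group X R) G"
  by (rule homI)
    (auto elim!: presented_carrierE simp: presented_mult words_append word_eval_append[OF assms(1)]
      induced_word_eval[OF assms] word_eval_closed[OF assms(1)])


section \<open>Tensor square and exterior square\<close>

definition conj_act :: "('a, 'm) monoid_scheme \<Rightarrow> 'a \<Rightarrow> 'a \<Rightarrow> 'a" where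
  "conj_act G x y = x \<otimes>\<^bsub>G\<^esub> y \<otimes>\<^bsub>G\<^esub> inv\<^bsub>G\<^esub> x"

definition commutator :: "('a, 'm) monoid_scheme \<Rightarrow> 'a \<Rightarrow> 'a \<Rightarrow> 'a" where
  "commutator G x y = x \<otimes>\<^bsub>G\<^esub> y \<otimes>\<^bsub>G\<^esub> inv\<^bsub>G\<^esub> x \<otimes>\<^bsub>G\<^esub> inv\<^bsub>G\<^esub> y"

abbreviation commutator_subgroup :: "('a, 'm) monoid_scheme \<Rightarrow> ('a, 'm) monoid_scheme" where
  "commutator_subgroup G \<equiv> G\<lparr>carrier := derived G (carrier G)\<rparr>"

definition tensor_rels ::
  "('a, 'm) monoid_scheme \<Rightarrow> (('a \<times> 'a) word \<times> ('a \<times> 'a) word) set" where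
  "tensor_rels G =
     {([((g \<otimes>\<^bsub>G\<^esub> g', h), True)],
       [((conj_act G g g', conj_act G g h), True), ((g, h), True)]) | g g' h.
        g \<in> carrier G \<and> g' \<in> carrier G \<and> h \<in> carrier G} \<union>
     {([((g, h \<otimes>\<^bsub>G\<^esub> h'), True)],
       [((g, h), True), ((conj_act G h g, conj_act G h h'), True)]) | g h h'.
        g \<in> carrier G \<and> h \<in> carrier G \<and> h' \<in> carrier G}"

definition tensor_square :: "('a, 'm) monoid_scheme \<Rightarrow> ('a \<times> 'a) word set monoid" where
  "tensor_square G = presented_group (carrier G \<times> carrier G) (tensor_rels G)"

definition tensor :: "('a, 'm) monoid_scheme \<Rightarrow> 'a \<Rightarrow> 'a \<Rightarrow> ('a \<times> 'a) word set" where
  "tensor G g h = pres_rel (carrier G \<times> carrier G) (tensor_rels G) `` {[((g, h), True)]}"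

definition normal_closure :: "('a, 'm) monoid_scheme \<Rightarrow> 'a set \<Rightarrow> 'a set" where
  "normal_closure G S = \<Inter>{N. N \<lhd> G \<and> S \<subseteq> N}"

definition diagonal_closure :: "('a, 'm) monoid_scheme \<Rightarrow> ('a \<times> 'a) word set set" where
  "diagonal_closure G = normal_closure (tensor_square G) {tensor G g g | g. g \<in> carrier G}"

definition exterior_square :: "('a, 'm) monoid_scheme \<Rightarrow> ('a \<times> 'a) word set set monoid" where
  "exterior_square G = tensor_square G Mod diagonal_closure G"

definition tensor_commutator :: "('a, 'm) monoid_scheme \<Rightarrow> ('a \<times> 'a) word set \<Rightarrow> 'a" where
  "tensor_commutator G = induced (word_eval G (\<lambda>(g, h). commutator G g h))"

definition exterior_commutator :: "('a, 'm) monoid_scheme \<Rightarrow> ('a \<times> 'a) word set set \<Rightarrow> 'a" where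
  "exterior_commutator G = induced (tensor_commutator G)"

definition tensor_map ::
  "('a, 'm) monoid_scheme \<Rightarrow> ('c \<Rightarrow> 'a) \<Rightarrow> ('c \<times> 'c) word set \<Rightarrow> ('a \<times> 'a) word set" where
  "tensor_map G f = induced (word_eval (tensor_square G) (\<lambda>(g, h). tensor G (f g) (f h)))"

definition exterior_map ::
  "('a, 'm) monoid_scheme \<Rightarrow> ('c \<Rightarrow> 'a) \<Rightarrow> ('c \<times> 'c) word set set \<Rightarrow> ('a \<times> 'a) word set set" where
  "exterior_map G f =
     induced (\<lambda>t. diagonal_closure G #>\<^bsub>tensor_square G\<^esub> tensor_map G f t)"

definition J2 :: "('a, 'm) monoid_scheme \<Rightarrow> ('a \<times> 'a) word set set" where
  "J2 G = kernel (tensor_square G) (commutator_subgroup G) (tensor_commutator G)"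

text \<open>The second integral homology group, under its natural identification with the kernel of the
  commutator map on the exterior square; \<open>f\<^sub>*\<close> is then the restriction of \<open>f \<and> f\<close>.\<close>

definition H2 :: "('a, 'm) monoid_scheme \<Rightarrow> ('a \<times> 'a) word set set set" where
  "H2 G = kernel (exterior_square G) (commutator_subgroup G) (exterior_commutator G)"

definition J2_image where "J2_image \<Gamma> G f = tensor_map G f ` J2 \<Gamma>"

definition H2_image where "H2_image \<Gamma> G f = exterior_map G f ` H2 \<Gamma>"

definition rel_tensor_square where
  "rel_tensor_square \<Gamma> G f = tensor_square G Mod J2_image \<Gamma> G f"

definition rel_exterior_square where
  "rel_exterior_square \<Gamma> G f = exterior_square G Mod H2_image \<Gamma> G f"

definition J2_quotient where
  "J2_quotient \<Gamma> G f = (tensor_square G)\<lparr>carrier := J2 G\<rparr> Mod J2_image \<Gamma> G f"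

definition H2_quotient where
  "H2_quotient \<Gamma> G f = (exterior_square G)\<lparr>carrier := H2 G\<rparr> Mod H2_image \<Gamma> G f"


subsection \<open>Well-definedness of the maps on the tensor square\<close>

lemma group_tensor_square: "group (tensor_square G)"
  by (simp add: tensor_square_def group_presented_group)

lemma tensor_closed:
  "g \<in> carrier G \<Longrightarrow> h \<in> carrier G \<Longrightarrow> tensor G g h \<in> carrier (tensor_square G)"
  by (auto simp: tensor_def tensor_square_def words_def intro!: presented_carrierI)

lemma tensor_rel_left:
  assumes "group G" "g \<in> carrier G" "g' \<in> carrier G" "h \<in> carrier G"
  shows "tensor G (g \<otimes>\<^bsub>G\<^esub> g') h =
    tensor G (conj_act G g g') (conj_act G g h) \<otimes>\<^bsub>tensor_square G\<^esub> tensor G g h"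
proof -
  interpret group G by fact
  let ?X = "carrier G \<times> carrier G"
  let ?v = "[((conj_act G g g', conj_act G g h), True), ((g, h), True)]"
  have "pres_eq ?X (tensor_rels G) [((g \<otimes>\<^bsub>G\<^esub> g', h), True)] ?v"
    by (rule pe_rel) (use assms in \<open>auto simp: tensor_rels_def words_def conj_act_def\<close>)
  then have "tensor G (g \<otimes>\<^bsub>G\<^esub> g') h = pres_rel ?X (tensor_rels G) `` {?v}"
    unfolding tensor_def by (intro equiv_class_eq[OF equiv_pres_rel]) (simp add: pres_rel_def)
  then show ?thesis
    using assms by (simp add: tensor_def tensor_square_def presented_mult words_def conj_act_def)
qed

lemma tensor_rel_right:
  assumes "group G" "g \<in> carrier G" "h \<in> carrier G" "h' \<in> carrier G"
  shows "tensor G g (h \<otimes>\<^bsub>G\<^esub> h') =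
    tensor G g h \<otimes>\<^bsub>tensor_square G\<^esub> tensor G (conj_act G h g) (conj_act G h h')"
proof -
  interpret group G by fact
  let ?X = "carrier G \<times> carrier G"
  let ?v = "[((g, h), True), ((conj_act G h g, conj_act G h h'), True)]"
  have "pres_eq ?X (tensor_rels G) [((g, h \<otimes>\<^bsub>G\<^esub> h'), True)] ?v"
    by (rule pe_rel) (use assms in \<open>auto simp: tensor_rels_def words_def conj_act_def\<close>)
  then have "tensor G g (h \<otimes>\<^bsub>G\<^esub> h') = pres_rel ?X (tensor_rels G) `` {?v}"
    unfolding tensor_def by (intro equiv_class_eq[OF equiv_pres_rel]) (simp add: pres_rel_def)
  then show ?thesis
    using assms by (simp add: tensor_def tensor_square_def presented_mult words_def conj_act_def)
qed

lemma word_eval_letter: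
  assumes "group H" "\<phi> x \<in> carrier H"
  shows "word_eval H \<phi> [(x, True)] = \<phi> x"
proof -
  interpret group H by fact
  show ?thesis using assms by (simp add: word_eval_def)
qed

lemma word_eval_two_letters:
  assumes "group H" "\<phi> x \<in> carrier H" "\<phi> y \<in> carrier H"
  shows "word_eval H \<phi> [(x, True), (y, True)] = \<phi> x \<otimes>\<^bsub>H\<^esub> \<phi> y"
proof -
  interpret group H by fact
  show ?thesis using assms by (simp add: word_eval_def)
qed

text \<open>A map satisfying the two defining relations extends to the tensor square.\<close>

lemma tensor_universal:
  assumes G: "group G" and H: "group H"
    and cl: "\<And>g h. g \<in> carrier G \<Longrightarrow> h \<in> carrier G \<Longrightarrow> \<beta> g h \<in> carrier H"
    and l: "\<And>g g' h. g \<in> carrier G \<Longrightarrow> g' \<in> carrier G \<Longrightarrow> h \<in> carrier G \<Longrightarrow>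
      \<beta> (g \<otimes>\<^bsub>G\<^esub> g') h = \<beta> (conj_act G g g') (conj_act G g h) \<otimes>\<^bsub>H\<^esub> \<beta> g h"
    and r: "\<And>g h h'. g \<in> carrier G \<Longrightarrow> h \<in> carrier G \<Longrightarrow> h' \<in> carrier G \<Longrightarrow>
      \<beta> g (h \<otimes>\<^bsub>G\<^esub> h') = \<beta> g h \<otimes>\<^bsub>H\<^esub> \<beta> (conj_act G h g) (conj_act G h h')"
  shows "induced (word_eval H (\<lambda>(g, h). \<beta> g h)) \<in> hom (tensor_square G) H"
    and "g \<in> carrier G \<Longrightarrow> h \<in> carrier G \<Longrightarrow>
      induced (word_eval H (\<lambda>(g, h). \<beta> g h)) (tensor G g h) = \<beta> g h"
proof -
  interpret G: group G by fact
  interpret H: group H by fact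
  let ?b = "\<lambda>(g, h). \<beta> g h"
  have 1: "?b \<in> carrier G \<times> carrier G \<rightarrow> carrier H" using cl by auto
  have c: "conj_act G x y \<in> carrier G" if "x \<in> carrier G" "y \<in> carrier G" for x y
    using that by (simp add: conj_act_def)
  have 2: "word_eval H ?b u = word_eval H ?b v" if "(u, v) \<in> tensor_rels G" for u v
    using that unfolding tensor_rels_def
    by (auto simp: word_eval_letter[OF H] word_eval_two_letters[OF H] cl c l r)
  show "induced (word_eval H ?b) \<in> hom (tensor_square G) H"
    unfolding tensor_square_def by (rule H.induced_word_eval_hom[OF 1 2])
  show "induced (word_eval H ?b) (tensor G g h) = \<beta> g h" if "g \<in> carrier G" "h \<in> carrier G"
  proof -
    have "induced (word_eval H ?b) (tensor G g h) = word_eval H ?b [((g, h), True)]"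
      unfolding tensor_def by (rule H.induced_word_eval[OF 1 2]) (use that in \<open>auto simp: words_def\<close>)
    then show ?thesis using that by (simp add: word_eval_letter[OF H] cl)
  qed
qed

lemma tensor_commutator_hom:
  assumes "group G"
  shows "tensor_commutator G \<in> hom (tensor_square G) G"
    and "g \<in> carrier G \<Longrightarrow> h \<in> carrier G \<Longrightarrow>
      tensor_commutator G (tensor G g h) = commutator G g h"
proof -
  interpret group G by fact
  have k: "inv\<^bsub>G\<^esub> x \<otimes>\<^bsub>G\<^esub> (x \<otimes>\<^bsub>G\<^esub> y) = y" "x \<otimes>\<^bsub>G\<^esub> (inv\<^bsub>G\<^esub> x \<otimes>\<^bsub>G\<^esub> y) = y"
    if "x \<in> carrier G" "y \<in> carrier G" for x y
    using that by (simp_all flip: m_assoc)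
  have l: "commutator G (g \<otimes>\<^bsub>G\<^esub> g') h =
      commutator G (conj_act G g g') (conj_act G g h) \<otimes>\<^bsub>G\<^esub> commutator G g h"
    and r: "commutator G h (g \<otimes>\<^bsub>G\<^esub> g') =
      commutator G h g \<otimes>\<^bsub>G\<^esub> commutator G (conj_act G g h) (conj_act G g g')"
    if "g \<in> carrier G" "g' \<in> carrier G" "h \<in> carrier G" for g g' h
    using that by (simp_all add: commutator_def conj_act_def m_assoc inv_mult_group k)
  have cl: "commutator G g h \<in> carrier G" if "g \<in> carrier G" "h \<in> carrier G" for g h
    using that by (simp add: commutator_def)
  show "tensor_commutator G \<in> hom (tensor_square G) G"
    unfolding tensor_commutator_def by (rule tensor_universal(1)[OF assms assms cl l r])
  show "g \<in> carrier G \<Longrightarrow> h \<in> carrier G \<Longrightarrow> tensor_commutator G (tensor G g h) = commutator G g h"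
    unfolding tensor_commutator_def by (rule tensor_universal(2)[OF assms assms cl l r])
qed

lemma tensor_map_hom:
  assumes "group \<Gamma>" "group G" "f \<in> hom \<Gamma> G"
  shows "tensor_map G f \<in> hom (tensor_square \<Gamma>) (tensor_square G)"
    and "g \<in> carrier \<Gamma> \<Longrightarrow> h \<in> carrier \<Gamma> \<Longrightarrow> tensor_map G f (tensor \<Gamma> g h) = tensor G (f g) (f h)"
proof -
  interpret group_hom \<Gamma> G f by (simp add: assms group_hom.intro group_hom_axioms.intro)
  have c: "f (conj_act \<Gamma> x y) = conj_act G (f x) (f y)" if "x \<in> carrier \<Gamma>" "y \<in> carrier \<Gamma>" for x y
    using that by (simp add: conj_act_def)
  have cl: "tensor G (f g) (f h) \<in> carrier (tensor_square G)"
    if "g \<in> carrier \<Gamma>" "h \<in> carrier \<Gamma>" for g h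
    using that by (simp add: tensor_closed)
  have l: "tensor G (f (g \<otimes>\<^bsub>\<Gamma>\<^esub> g')) (f h) =
      tensor G (f (conj_act \<Gamma> g g')) (f (conj_act \<Gamma> g h)) \<otimes>\<^bsub>tensor_square G\<^esub> tensor G (f g) (f h)"
    if "g \<in> carrier \<Gamma>" "g' \<in> carrier \<Gamma>" "h \<in> carrier \<Gamma>" for g g' h
    using that by (simp add: c tensor_rel_left assms(2))
  have r: "tensor G (f g) (f (h \<otimes>\<^bsub>\<Gamma>\<^esub> h')) =
      tensor G (f g) (f h) \<otimes>\<^bsub>tensor_square G\<^esub> tensor G (f (conj_act \<Gamma> h g)) (f (conj_act \<Gamma> h h'))"
    if "g \<in> carrier \<Gamma>" "h \<in> carrier \<Gamma>" "h' \<in> carrier \<Gamma>" for g h h'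
    using that by (simp add: c tensor_rel_right assms(2))
  note u = tensor_universal[OF assms(1) group_tensor_square, of "\<lambda>g h. tensor G (f g) (f h)", OF cl l r]
  show "tensor_map G f \<in> hom (tensor_square \<Gamma>) (tensor_square G)"
    unfolding tensor_map_def by (rule u(1))
  show "g \<in> carrier \<Gamma> \<Longrightarrow> h \<in> carrier \<Gamma> \<Longrightarrow> tensor_map G f (tensor \<Gamma> g h) = tensor G (f g) (f h)"
    unfolding tensor_map_def by (rule u(2))
qed


section \<open>Orderability, torsion and central extensions\<close>

definition left_orderable :: "('a, 'm) monoid_scheme \<Rightarrow> bool" where
  "left_orderable G \<longleftrightarrow>
     (\<exists>lt. irreflp_on (carrier G) lt \<and> transp_on (carrier G) lt \<and> totalp_on (carrier G) lt \<and>
       (\<forall>g\<in>carrier G. \<forall>x\<in>carrier G. \<forall>y\<in>carrier G.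
          lt x y \<longrightarrow> lt (g \<otimes>\<^bsub>G\<^esub> x) (g \<otimes>\<^bsub>G\<^esub> y)))"

definition circularly_orderable :: "('a, 'm) monoid_scheme \<Rightarrow> bool" where
  "circularly_orderable G \<longleftrightarrow>
     (\<exists>c :: 'a \<Rightarrow> 'a \<Rightarrow> 'a \<Rightarrow> int.
       (\<forall>x\<in>carrier G. \<forall>y\<in>carrier G. \<forall>z\<in>carrier G. c x y z \<in> {-1, 0, 1}) \<and>
       (\<forall>x\<in>carrier G. \<forall>y\<in>carrier G. \<forall>z\<in>carrier G.
          c x y z = 0 \<longleftrightarrow> \<not> (x \<noteq> y \<and> y \<noteq> z \<and> x \<noteq> z)) \<and>
       (\<forall>w\<in>carrier G. \<forall>x\<in>carrier G. \<forall>y\<in>carrier G. \<forall>z\<in>carrier G.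
          c x y z - c w y z + c w x z - c w x y = 0) \<and>
       (\<forall>g\<in>carrier G. \<forall>x\<in>carrier G. \<forall>y\<in>carrier G. \<forall>z\<in>carrier G.
          c (g \<otimes>\<^bsub>G\<^esub> x) (g \<otimes>\<^bsub>G\<^esub> y) (g \<otimes>\<^bsub>G\<^esub> z) = c x y z))"

definition torsion_free :: "('a, 'm) monoid_scheme \<Rightarrow> bool" where
  "torsion_free G \<longleftrightarrow>
     (\<forall>x\<in>carrier G. \<forall>n::nat. 0 < n \<and> x [^]\<^bsub>G\<^esub> n = \<one>\<^bsub>G\<^esub> \<longrightarrow> x = \<one>\<^bsub>G\<^esub>)"

definition center :: "('a, 'm) monoid_scheme \<Rightarrow> 'a set" where
  "center G = {z \<in> carrier G. \<forall>x\<in>carrier G. z \<otimes>\<^bsub>G\<^esub> x = x \<otimes>\<^bsub>G\<^esub> z}"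

definition f_extension ::
  "('c, 'l) monoid_scheme \<Rightarrow> ('a, 'm) monoid_scheme \<Rightarrow> ('c \<Rightarrow> 'a) \<Rightarrow>
   ('b, 'n) monoid_scheme \<Rightarrow> ('b \<Rightarrow> 'a) \<Rightarrow> bool" where
  "f_extension \<Gamma> G f E p \<longleftrightarrow>
     group E \<and> p \<in> epi E G \<and> (\<exists>f'\<in>hom \<Gamma> E. \<forall>x\<in>carrier \<Gamma>. p (f' x) = f x)"

definition central_f_extension ::
  "('c, 'l) monoid_scheme \<Rightarrow> ('a, 'm) monoid_scheme \<Rightarrow> ('c \<Rightarrow> 'a) \<Rightarrow>
   ('b, 'n) monoid_scheme \<Rightarrow> ('b \<Rightarrow> 'a) \<Rightarrow> bool" where
  "central_f_extension \<Gamma> G f E p \<longleftrightarrow> f_extension \<Gamma> G f E p \<and> kernel E G p \<subseteq> center E"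

end

theory Submission
  imports Defs
begin

text \<open>Let \<open>p : E \<rightarrow> G\<close> be a central extension. A commutator in \<open>E\<close> does not change when its entries are
  multiplied by central elements, so \<open>g \<otimes> h \<mapsto> [x, y]\<close>, for any \<open>x\<close> over \<open>g\<close> and \<open>y\<close> over \<open>h\<close>, is a
  well-defined homomorphism \<open>\<delta> : G \<otimes> G \<rightarrow> E\<close> (\<open>central_extension_commutator_hom\<close>). It satisfies
  \<open>p \<circ> \<delta> = [\<cdot>,\<cdot>]\<close>, and if \<open>f'\<close> is a lift of \<open>f\<close> then \<open>\<delta> \<circ> (f \<otimes> f) = f' \<circ> [\<cdot>,\<cdot>]\<close>. The second identity
  shows that \<open>\<delta>\<close> kills the image of \<open>J\<^sub>2(\<Gamma>)\<close>, hence descends to the relative tensor square; the first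
  shows that the kernel of the descended map lies in \<open>J\<^sub>2(G) / (f \<otimes> f)(J\<^sub>2(\<Gamma>))\<close>. Since \<open>\<delta>\<close> kills
  every \<open>g \<otimes> g\<close>, the same happens for the exterior square with \<open>H\<^sub>2\<close> in place of \<open>J\<^sub>2\<close>.

  So each relative square maps to \<open>E\<close> with a torsion-free central kernel. A torsion-free abelian
  group is left-orderable (\<open>torsion_free_left_orderable\<close>), and a left order on the kernel together
  with a left (circular) order on the target gives a left (circular) order on the source
  (\<open>left_orderable_extension\<close>, \<open>circularly_orderable_extension\<close>).

  Centrality of \<open>J\<^sub>2(G)\<close> and of its exterior counterpart, which also makes the quotients groups,
  comes from the crossed module identity \<open>t u t\<inverse> = \<^sup>d\<^sup>tu\<close> with \<open>d : G \<otimes> G \<rightarrow> G\<close> the commutator map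
  and the diagonal action of \<open>G\<close> (\<open>tensor_conj\<close>).\<close>

section \<open>Positive cones\<close>

text \<open>Left orders are handled through the set of elements above the identity: \<open>x < y\<close> means
  that \<open>x\<inverse>y\<close> lies in \<open>P\<close>. Disjointness of \<open>P\<close> and its inverse is implied: \<open>P\<close> is closed under
  products and does not contain the identity.\<close>

definition positive_cone :: "('a, 'm) monoid_scheme \<Rightarrow> 'a set \<Rightarrow> bool" where
  "positive_cone G P \<longleftrightarrow> P \<subseteq> carrier G \<and> \<one>\<^bsub>G\<^esub> \<notin> P \<and> (\<forall>p\<in>P. \<forall>q\<in>P. p \<otimes>\<^bsub>G\<^esub> q \<in> P) \<and>
     (\<forall>x\<in>carrier G. x \<noteq> \<one>\<^bsub>G\<^esub> \<longrightarrow> x \<in> P \<or> inv\<^bsub>G\<^esub> x \<in> P)"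

lemma (in group) ratio_mult:
  assumes "x \<in> carrier G" "y \<in> carrier G" "z \<in> carrier G"
  shows "inv x \<otimes> y \<otimes> (inv y \<otimes> z) = inv x \<otimes> z"
proof -
  have "inv x \<otimes> y \<otimes> (inv y \<otimes> z) = inv x \<otimes> (y \<otimes> inv y) \<otimes> z"
    using assms by (simp add: m_assoc del: r_inv) (simp flip: m_assoc)
  then show ?thesis using assms by simp
qed

lemma (in group) ratio_left:
  assumes "g \<in> carrier G" "x \<in> carrier G" "y \<in> carrier G"
  shows "inv (g \<otimes> x) \<otimes> (g \<otimes> y) = inv x \<otimes> y"
proof -
  have "inv (g \<otimes> x) \<otimes> (g \<otimes> y) = inv x \<otimes> (inv g \<otimes> g) \<otimes> y"
    using assms by (simp add: m_assoc inv_mult_group del: l_inv) (simp flip: m_assoc)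
  then show ?thesis using assms by simp
qed

lemma (in group) ratio_inv:
  "x \<in> carrier G \<Longrightarrow> y \<in> carrier G \<Longrightarrow> inv (inv x \<otimes> y) = inv y \<otimes> x"
  by (simp add: inv_mult_group)

lemma (in group) ratio_one_iff:
  "x \<in> carrier G \<Longrightarrow> y \<in> carrier G \<Longrightarrow> inv x \<otimes> y = \<one> \<longleftrightarrow> x = y"
  by (metis inv_equality inv_inv inv_closed l_inv)

lemma (in group) left_orderableI:
  assumes "positive_cone G P"
  shows "left_orderable G"
proof -
  have P: "\<one> \<notin> P" "\<And>p q. p \<in> P \<Longrightarrow> q \<in> P \<Longrightarrow> p \<otimes> q \<in> P"
    "\<And>x. x \<in> carrier G \<Longrightarrow> x \<noteq> \<one> \<Longrightarrow> x \<in> P \<or> inv x \<in> P"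
    using assms by (auto simp: positive_cone_def)
  show ?thesis unfolding left_orderable_def
  proof (intro exI[of _ "\<lambda>x y. inv x \<otimes> y \<in> P"] conjI ballI impI)
    show "irreflp_on (carrier G) (\<lambda>x y. inv x \<otimes> y \<in> P)"
      using P(1) by (auto intro: irreflp_onI)
    show "transp_on (carrier G) (\<lambda>x y. inv x \<otimes> y \<in> P)"
      by (rule transp_onI) (metis P(2) ratio_mult)
    show "totalp_on (carrier G) (\<lambda>x y. inv x \<otimes> y \<in> P)"
    proof (rule totalp_onI)
      fix x y assume xy: "x \<in> carrier G" "y \<in> carrier G" "x \<noteq> y"
      then show "inv x \<otimes> y \<in> P \<or> inv y \<otimes> x \<in> P"
        using P(3)[of "inv x \<otimes> y"] by (simp add: ratio_one_iff ratio_inv)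
    qed
  qed (simp add: ratio_left)
qed

lemma (in group) left_orderableE:
  assumes "left_orderable G"
  obtains P where "positive_cone G P"
proof -
  obtain lt where lt: "irreflp_on (carrier G) lt" "transp_on (carrier G) lt"
    "totalp_on (carrier G) lt" and
    inv: "\<And>g x y. g \<in> carrier G \<Longrightarrow> x \<in> carrier G \<Longrightarrow> y \<in> carrier G \<Longrightarrow> lt x y \<Longrightarrow> lt (g \<otimes> x) (g \<otimes> y)"
    using assms unfolding left_orderable_def by blast
  have "positive_cone G {x \<in> carrier G. lt \<one> x}"
    unfolding positive_cone_def
  proof (intro conjI ballI impI)
    show "\<one> \<notin> {x \<in> carrier G. lt \<one> x}" using lt(1) by (auto dest: irreflp_onD)
  next
    fix p q assume pq: "p \<in> {x \<in> carrier G. lt \<one> x}" "q \<in> {x \<in> carrier G. lt \<one> x}"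
    then have "lt p (p \<otimes> q)" using inv[of p \<one> q] by simp
    then have "lt \<one> (p \<otimes> q)" using transp_onD[OF lt(2), of \<one> p "p \<otimes> q"] pq by simp
    then show "p \<otimes> q \<in> {x \<in> carrier G. lt \<one> x}" using pq by simp
  next
    fix x assume x: "x \<in> carrier G" "x \<noteq> \<one>"
    then have "lt \<one> x \<or> lt x \<one>" using totalp_onD[OF lt(3)] by (metis one_closed)
    then show "x \<in> {x \<in> carrier G. lt \<one> x} \<or> inv x \<in> {x \<in> carrier G. lt \<one> x}"
      using inv[of "inv x" x \<one>] x by auto
  qed auto
  then show ?thesis by (rule that)
qed

section \<open>Orders on torsion-free abelian groups\<close>

text \<open>If the semigroup generated by \<open>M\<close> and \<open>x\<close> avoided the identity, it would contradict the
  maximality of \<open>M\<close>. So it contains the identity as some \<open>x\<^sup>n p\<close>, and then \<open>p = x\<^sup>-\<^sup>n\<close>, where \<open>p\<close> cannot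
  be the identity because \<open>x\<close> has infinite order.\<close>

lemma (in comm_group) maximal_semigroup_inverse_power:
  assumes M: "M \<subseteq> carrier G" "\<one> \<notin> M" "\<And>p q. p \<in> M \<Longrightarrow> q \<in> M \<Longrightarrow> p \<otimes> q \<in> M"
    and max: "\<And>S. M \<subseteq> S \<Longrightarrow> S \<subseteq> carrier G \<Longrightarrow> \<one> \<notin> S \<Longrightarrow>
      (\<And>p q. p \<in> S \<Longrightarrow> q \<in> S \<Longrightarrow> p \<otimes> q \<in> S) \<Longrightarrow> S = M"
    and tf: "torsion_free G"
    and x: "x \<in> carrier G" "x \<noteq> \<one>" "x \<notin> M"
  obtains n :: nat where "0 < n" "inv x [^] n \<in> M"
proof -
  (* The semigroup generated by M and x; the side condition excludes the empty product. *)
  define S where "S = {x [^] n \<otimes> p | (n::nat) p. p \<in> insert \<one> M \<and> (0 < n \<or> p \<in> M)}"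
  have M1: "p \<in> carrier G" if "p \<in> insert \<one> M" for p using that M(1) by auto
  have "M \<subseteq> S"
  proof
    fix p assume "p \<in> M"
    moreover from this have "p = x [^] (0::nat) \<otimes> p" using M1 by simp
    ultimately show "p \<in> S" unfolding S_def by blast
  qed
  moreover have "S \<subseteq> carrier G" using x(1) M1 by (auto simp: S_def)
  moreover have "p \<otimes> q \<in> S" if pq: "p \<in> S" "q \<in> S" for p q
  proof -
    obtain n :: nat and a where a: "p = x [^] n \<otimes> a" "a \<in> insert \<one> M" "0 < n \<or> a \<in> M"
      using pq(1) unfolding S_def by blast
    obtain m :: nat and b where b: "q = x [^] m \<otimes> b" "b \<in> insert \<one> M" "0 < m \<or> b \<in> M"
      using pq(2) unfolding S_def by blast
    note c = M1[OF a(2)] M1[OF b(2)]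
    have "p \<otimes> q = x [^] (n + m) \<otimes> (a \<otimes> b)"
      using c x(1) by (simp add: a(1) b(1) m_ac flip: nat_pow_mult)
    moreover have "a \<otimes> b \<in> insert \<one> M" using a(2) b(2) M(3) c by auto
    moreover have "0 < n + m \<or> a \<otimes> b \<in> M" using a(3) b(3) M(3) by auto
    ultimately show ?thesis unfolding S_def by blast
  qed
  moreover have "x \<in> S"
  proof -
    have "x = x [^] (1::nat) \<otimes> \<one>" using x(1) by simp
    moreover have "(0::nat) < 1" by simp
    ultimately show ?thesis unfolding S_def by blast
  qed
  ultimately have "\<one> \<in> S" using max x(3) by blast
  then obtain n :: nat and p where p: "x [^] n \<otimes> p = \<one>" "p \<in> insert \<one> M" "0 < n \<or> p \<in> M"
    unfolding S_def mem_Collect_eq by (elim exE conjE) (rule that, simp_all)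
  note pc = M1[OF p(2)]
  have n: "0 < n" using p M(2) pc by (cases "n = 0") auto
  have "p \<noteq> \<one>" using tf n p(1) x by (auto simp: torsion_free_def dest!: bspec[OF _ x(1)])
  then have "p \<in> M" using p(2) by blast
  moreover have "inv x [^] n = p"
    using inv_equality[of p "x [^] n"] p(1) x(1) pc by (simp add: nat_pow_inv m_comm)
  ultimately show ?thesis using that n by blast
qed

text \<open>A maximal semigroup \<open>M\<close> avoiding the identity, which exists by Zorn's lemma, is a positive
  cone: if neither \<open>x\<close> nor \<open>x\<inverse>\<close> were in \<open>M\<close>, it would contain \<open>x\<^sup>-\<^sup>n\<close> and \<open>x\<^sup>m\<close> for some positive \<open>n\<close> and
  \<open>m\<close>, hence also \<open>x\<^sup>-\<^sup>n\<^sup>m x\<^sup>n\<^sup>m = 1\<close>.\<close>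

lemma (in comm_group) torsion_free_left_orderable:
  assumes tf: "torsion_free G"
  shows "left_orderable G"
proof -
  define \<S> where "\<S> = {S. S \<subseteq> carrier G \<and> \<one> \<notin> S \<and> (\<forall>p\<in>S. \<forall>q\<in>S. p \<otimes> q \<in> S)}"
  have "\<exists>M\<in>\<S>. \<forall>S\<in>\<S>. M \<subseteq> S \<longrightarrow> S = M"
  proof (rule subset_Zorn')
    fix C assume C: "subset.chain \<S> C"
    then have C1: "S \<in> \<S>" if "S \<in> C" for S using that by (auto simp: subset_chain_def)
    have "p \<otimes> q \<in> \<Union>C" if "p \<in> S" "S \<in> C" "q \<in> S'" "S' \<in> C" for p q S S'
    proof -
      have "S \<subseteq> S' \<or> S' \<subseteq> S" using C that by (auto simp: subset_chain_def)
      then show ?thesis using that C1 unfolding \<S>_def by blast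
    qed
    then show "\<Union>C \<in> \<S>" using C1 unfolding \<S>_def by blast
  qed
  then obtain M where MS: "M \<in> \<S>" and max: "\<And>S. S \<in> \<S> \<Longrightarrow> M \<subseteq> S \<Longrightarrow> S = M" by blast
  then have M: "M \<subseteq> carrier G" "\<one> \<notin> M" "\<And>p q. p \<in> M \<Longrightarrow> q \<in> M \<Longrightarrow> p \<otimes> q \<in> M"
    by (auto simp: \<S>_def)
  have pow: "p [^] n \<in> M" if "p \<in> M" "0 < n" for p and n :: nat
    using that(2)
  proof (induction n)
    case (Suc n)
    then show ?case using M(1,3) that(1) by (cases "n = 0") auto
  qed simp
  have total: "x \<in> M \<or> inv x \<in> M" if x: "x \<in> carrier G" "x \<noteq> \<one>" for x
  proof (rule ccontr)
    assume n: "\<not> (x \<in> M \<or> inv x \<in> M)"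
    obtain n :: nat where n1: "0 < n" "inv x [^] n \<in> M"
      by (rule maximal_semigroup_inverse_power[OF M _ tf, of x]) (use max x n in \<open>auto simp: \<S>_def\<close>)
    obtain m :: nat where m1: "0 < m" "inv (inv x) [^] m \<in> M"
      by (rule maximal_semigroup_inverse_power[OF M _ tf, of "inv x"]) (use max x n in \<open>auto simp: \<S>_def\<close>)
    have "(inv x [^] n) [^] m \<otimes> (x [^] m) [^] n \<in> M"
      using M(3)[OF pow[OF n1(2) m1(1)] pow[OF m1(2) n1(1)]] x(1) by simp
    moreover have "(inv x [^] n) [^] m \<otimes> (x [^] m) [^] n = \<one>"
      using x by (simp add: nat_pow_pow nat_pow_inv mult.commute)
    ultimately show False using M(2) by simp
  qed
  have "positive_cone G M" using M total by (simp add: positive_cone_def)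
  then show ?thesis by (rule left_orderableI)
qed

section \<open>Orders on extensions\<close>

text \<open>The cone of a subgroup, expressed with the operations of the ambient group.\<close>

lemma (in group) positive_cone_subgroup:
  assumes "left_orderable (G\<lparr>carrier := K\<rparr>)" "subgroup K G"
  obtains P where "P \<subseteq> K" "\<one> \<notin> P" "\<And>p q. p \<in> P \<Longrightarrow> q \<in> P \<Longrightarrow> p \<otimes> q \<in> P"
    "\<And>x. x \<in> K \<Longrightarrow> x \<noteq> \<one> \<Longrightarrow> x \<in> P \<or> inv x \<in> P"
proof -
  interpret K: group "G\<lparr>carrier := K\<rparr>" by (rule subgroup.subgroup_is_group[OF assms(2) is_group])
  obtain P where P: "positive_cone (G\<lparr>carrier := K\<rparr>) P"
    using K.left_orderableE[OF assms(1)] .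
  show ?thesis
    by (rule that[of P]) (use P m_inv_consistent[OF assms(2)] in \<open>auto simp: positive_cone_def\<close>)
qed

text \<open>The order is lexicographic: images are compared first, and ties are decided in the kernel.\<close>

lemma (in group_hom) left_orderable_extension:
  assumes K: "left_orderable (G\<lparr>carrier := kernel G H h\<rparr>)" and Q: "left_orderable H"
  shows "left_orderable G"
proof -
  obtain P where P: "P \<subseteq> kernel G H h" "\<one>\<^bsub>G\<^esub> \<notin> P" "\<And>p q. p \<in> P \<Longrightarrow> q \<in> P \<Longrightarrow> p \<otimes>\<^bsub>G\<^esub> q \<in> P"
    "\<And>x. x \<in> kernel G H h \<Longrightarrow> x \<noteq> \<one>\<^bsub>G\<^esub> \<Longrightarrow> x \<in> P \<or> inv\<^bsub>G\<^esub> x \<in> P"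
    using G.positive_cone_subgroup[OF K subgroup_kernel] by blast
  obtain R where R: "positive_cone H R" using H.left_orderableE[OF Q] .
  have PK: "p \<in> carrier G \<and> h p = \<one>\<^bsub>H\<^esub>" if "p \<in> P" for p using that P(1) by (auto simp: kernel_def)
  have R1: "h x \<in> R \<or> inv\<^bsub>H\<^esub> h x \<in> R" if "x \<in> carrier G" "h x \<noteq> \<one>\<^bsub>H\<^esub>" for x
    using R that by (simp add: positive_cone_def)
  have P1: "x \<in> P \<or> inv\<^bsub>G\<^esub> x \<in> P" if "x \<in> carrier G" "h x = \<one>\<^bsub>H\<^esub>" "x \<noteq> \<one>\<^bsub>G\<^esub>" for x
    using P(4) that by (simp add: kernel_def)
  have "positive_cone G ({x \<in> carrier G. h x \<in> R} \<union> P)"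
    unfolding positive_cone_def
  proof (intro conjI ballI impI)
    fix x assume "x \<in> carrier G" "x \<noteq> \<one>\<^bsub>G\<^esub>"
    then show "x \<in> {x \<in> carrier G. h x \<in> R} \<union> P \<or> inv\<^bsub>G\<^esub> x \<in> {x \<in> carrier G. h x \<in> R} \<union> P"
      using R1[of x] P1[of x] by auto
  qed (use R P(2,3) PK in \<open>auto simp: positive_cone_def subset_iff\<close>)
  then show ?thesis by (rule G.left_orderableI)
qed

text \<open>Let \<open>u x y \<in> {-1, 0, 1}\<close> be the sign of \<open>x\<inverse>y\<close> for the order of the kernel if \<open>x\<close> and \<open>y\<close> have the
  same image, and \<open>0\<close> otherwise. The order sought is the pull-back of the given cocycle plus the
  coboundary \<open>u x y + u y z + u z x\<close> of \<open>u\<close>. In this form the cocycle identity and the invariance are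
  immediate. The pull-back vanishes exactly when two of the images coincide, and then the
  coboundary supplies the missing sign; the coboundary vanishes when all images differ.\<close>

lemma (in group_hom) circularly_orderable_extension:
  assumes K: "left_orderable (G\<lparr>carrier := kernel G H h\<rparr>)" and Q: "circularly_orderable H"
  shows "circularly_orderable G"
proof -
  obtain P where P: "P \<subseteq> kernel G H h" "\<one>\<^bsub>G\<^esub> \<notin> P" "\<And>p q. p \<in> P \<Longrightarrow> q \<in> P \<Longrightarrow> p \<otimes>\<^bsub>G\<^esub> q \<in> P"
    "\<And>x. x \<in> kernel G H h \<Longrightarrow> x \<noteq> \<one>\<^bsub>G\<^esub> \<Longrightarrow> x \<in> P \<or> inv\<^bsub>G\<^esub> x \<in> P"
    using G.positive_cone_subgroup[OF K subgroup_kernel] by blast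
  obtain c :: "'c \<Rightarrow> 'c \<Rightarrow> 'c \<Rightarrow> int" where
    C: "\<forall>x\<in>carrier H. \<forall>y\<in>carrier H. \<forall>z\<in>carrier H. c x y z \<in> {-1, 0, 1}"
      "\<forall>x\<in>carrier H. \<forall>y\<in>carrier H. \<forall>z\<in>carrier H.
        c x y z = 0 \<longleftrightarrow> \<not> (x \<noteq> y \<and> y \<noteq> z \<and> x \<noteq> z)"
      "\<forall>w\<in>carrier H. \<forall>x\<in>carrier H. \<forall>y\<in>carrier H. \<forall>z\<in>carrier H.
        c x y z - c w y z + c w x z - c w x y = 0"
      "\<forall>g\<in>carrier H. \<forall>x\<in>carrier H. \<forall>y\<in>carrier H. \<forall>z\<in>carrier H.
        c (g \<otimes>\<^bsub>H\<^esub> x) (g \<otimes>\<^bsub>H\<^esub> y) (g \<otimes>\<^bsub>H\<^esub> z) = c x y z"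
    using Q unfolding circularly_orderable_def by (elim exE conjE) (rule that)
  note c1 = C(1)[rule_format] and c2 = C(2)[rule_format] and c3 = C(3)[rule_format]
    and c4 = C(4)[rule_format]
  define u :: "'a \<Rightarrow> 'a \<Rightarrow> int" where
    "u x y = (if inv\<^bsub>G\<^esub> x \<otimes>\<^bsub>G\<^esub> y \<in> P then 1 else if inv\<^bsub>G\<^esub> y \<otimes>\<^bsub>G\<^esub> x \<in> P then -1 else 0)" for x y
  have asym: False if "inv\<^bsub>G\<^esub> x \<otimes>\<^bsub>G\<^esub> y \<in> P" "inv\<^bsub>G\<^esub> y \<otimes>\<^bsub>G\<^esub> x \<in> P" "x \<in> carrier G" "y \<in> carrier G" for x y
    using P(3)[OF that(1,2)] P(2) that(3,4) by (simp add: G.ratio_mult)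
  have anti: "u x y = - u y x" if "x \<in> carrier G" "y \<in> carrier G" for x y
    using asym that by (auto simp: u_def)
  have inv: "u (g \<otimes>\<^bsub>G\<^esub> x) (g \<otimes>\<^bsub>G\<^esub> y) = u x y" if "g \<in> carrier G" "x \<in> carrier G" "y \<in> carrier G" for g x y
    using that by (simp add: u_def G.ratio_left)
  have val: "u x y \<in> {-1, 0, 1}" for x y by (simp add: u_def)
  have zero: "u x y = 0 \<longleftrightarrow> x = y \<or> h x \<noteq> h y" if "x \<in> carrier G" "y \<in> carrier G" for x y
  proof -
    have "inv\<^bsub>G\<^esub> x \<otimes>\<^bsub>G\<^esub> y \<in> kernel G H h \<longleftrightarrow> h x = h y"
      using that by (auto simp: kernel_def H.ratio_one_iff)
    moreover have "inv\<^bsub>G\<^esub> y \<otimes>\<^bsub>G\<^esub> x \<in> kernel G H h \<longleftrightarrow> h x = h y"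
      using that by (auto simp: kernel_def H.ratio_one_iff)
    moreover have "inv\<^bsub>G\<^esub> x \<otimes>\<^bsub>G\<^esub> y \<in> P \<or> inv\<^bsub>G\<^esub> y \<otimes>\<^bsub>G\<^esub> x \<in> P" if "inv\<^bsub>G\<^esub> x \<otimes>\<^bsub>G\<^esub> y \<in> kernel G H h" "x \<noteq> y"
      using P(4)[OF that(1)] that(2) \<open>x \<in> carrier G\<close> \<open>y \<in> carrier G\<close>
      by (simp add: G.ratio_one_iff G.ratio_inv)
    moreover have "inv\<^bsub>G\<^esub> x \<otimes>\<^bsub>G\<^esub> x \<notin> P" using P(2) that by simp
    ultimately show ?thesis using P(1) by (auto simp: u_def)
  qed
  have tr: "u x z = 1" if "u x y = 1" "u y z = 1" "x \<in> carrier G" "y \<in> carrier G" "z \<in> carrier G" for x y z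
  proof -
    have "inv\<^bsub>G\<^esub> x \<otimes>\<^bsub>G\<^esub> y \<in> P" "inv\<^bsub>G\<^esub> y \<otimes>\<^bsub>G\<^esub> z \<in> P" using that(1,2) by (simp_all add: u_def split: if_splits)
    then have "inv\<^bsub>G\<^esub> x \<otimes>\<^bsub>G\<^esub> z \<in> P" using P(3) that(3-5) by (metis G.ratio_mult)
    then show ?thesis by (simp add: u_def)
  qed
  define c' where "c' x y z = c (h x) (h y) (h z) + (u x y + u y z + u z x)" for x y z
  have main: "c' x y z \<in> {-1, 0, 1} \<and> (c' x y z = 0 \<longleftrightarrow> \<not> (x \<noteq> y \<and> y \<noteq> z \<and> x \<noteq> z))"
    if X: "x \<in> carrier G" "y \<in> carrier G" "z \<in> carrier G" for x y z
  proof (cases "h x \<noteq> h y \<and> h y \<noteq> h z \<and> h x \<noteq> h z")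
    case True
    then have "u x y = 0" "u y z = 0" "u z x = 0" using zero X by auto
    moreover have "c (h x) (h y) (h z) \<noteq> 0" using True c2 X by simp
    ultimately show ?thesis using True c1[of "h x" "h y" "h z"] X by (auto simp: c'_def)
  next
    case False
    then have "c (h x) (h y) (h z) = 0" using c2 X by simp
    then have c': "c' x y z = u x y + u y z + u z x" by (simp add: c'_def)
    note A = anti[OF X(1,2)] anti[OF X(2,3)] anti[OF X(3,1)]
    note Z = zero[OF X(1,2)] zero[OF X(2,3)] zero[OF X(3,1)]
    show ?thesis
    proof (cases "x \<noteq> y \<and> y \<noteq> z \<and> x \<noteq> z")
      case distinct: True
      (* In one coset the three signs cannot agree, since u orders it linearly; with exactly two
         images equal, exactly one of the three signs is nonzero. *)
      have "u x y + u y z + u z x \<in> {-1, 1}"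
      proof (cases "h x = h y \<and> h y = h z")
        case True
        have "\<not> (u x y = 1 \<and> u y z = 1 \<and> u z x = 1)" using tr[OF _ _ X] A(3) by auto
        moreover have "\<not> (u x y = -1 \<and> u y z = -1 \<and> u z x = -1)"
          using tr[OF _ _ X(3,2,1)] A by auto
        ultimately show ?thesis
          using Z distinct True val[of x y] val[of y z] val[of z x] by auto
      next
        case False
        then show ?thesis
          using Z distinct \<open>\<not> (h x \<noteq> h y \<and> h y \<noteq> h z \<and> h x \<noteq> h z)\<close>
            val[of x y] val[of y z] val[of z x] by auto
      qed
      then show ?thesis using distinct c' by auto
    next
      case False
      then have "u x y + u y z + u z x = 0" using A Z by auto
      then show ?thesis using False c' by simp
    qed
  qed
  show ?thesis
    unfolding circularly_orderable_def
  proof (intro exI[of _ c'] conjI ballI)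
    fix w x y z assume X: "w \<in> carrier G" "x \<in> carrier G" "y \<in> carrier G" "z \<in> carrier G"
    show "c' x y z - c' w y z + c' w x z - c' w x y = 0"
      using c3[of "h w" "h x" "h y" "h z"] anti[of z x] anti[of z w] anti[of y w] X
      by (simp add: c'_def)
  next
    fix x y z assume X: "x \<in> carrier G" "y \<in> carrier G" "z \<in> carrier G"
    show "c' x y z \<in> {-1, 0, 1}" "c' x y z = 0 \<longleftrightarrow> \<not> (x \<noteq> y \<and> y \<noteq> z \<and> x \<noteq> z)"
      using main[OF X] by blast+
  qed (simp add: c'_def c4 inv)
qed

section \<open>Homomorphisms on quotient groups\<close>

lemma group_homI: "group G \<Longrightarrow> group H \<Longrightarrow> h \<in> hom G H \<Longrightarrow> group_hom G H h"
  by (intro group_hom.intro group_hom_axioms.intro)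

lemma induced_coset:
  assumes T: "N \<lhd> T" and H: "group H" and h: "h \<in> hom T H" and N: "\<And>n. n \<in> N \<Longrightarrow> h n = \<one>\<^bsub>H\<^esub>"
    and t: "t \<in> carrier T"
  shows "induced h (N #>\<^bsub>T\<^esub> t) = h t"
proof -
  interpret normal N T by fact
  interpret group_hom T H h by (rule group_homI[OF is_group H h])
  have "h (n \<otimes>\<^bsub>T\<^esub> t) = h t" if "n \<in> N" for n using that t N by simp
  moreover have "N \<noteq> {}" using subgroup_nonempty subgroup_axioms by blast
  ultimately have "h ` (N #>\<^bsub>T\<^esub> t) = {h t}" by (auto simp: r_coset_def image_UN)
  then show ?thesis by (simp add: induced_def)
qed

lemma induced_coset_hom:
  assumes T: "N \<lhd> T" and H: "group H" and h: "h \<in> hom T H" and N: "\<And>n. n \<in> N \<Longrightarrow> h n = \<one>\<^bsub>H\<^esub>"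
  shows "induced h \<in> hom (T Mod N) H"
proof -
  interpret normal N T by fact
  show ?thesis
    by (rule homI)
      (auto simp: FactGroup_def RCOSETS_def rcos_sum induced_coset[OF assms] hom_in_carrier[OF h]
        hom_mult[OF h])
qed

text \<open>The homomorphism that \<open>\<delta>\<close> induces on \<open>T Mod N\<close> has its kernel inside the image of \<open>Z\<close>, which
  is central and torsion-free. That kernel is therefore left-orderable, and the results on
  extensions apply.\<close>

lemma orderable_central_quotient:
  assumes T: "group T" and E: "group E" and \<delta>: "\<delta> \<in> hom T E"
    and Z: "subgroup Z T" "Z \<subseteq> center T" and N: "subgroup N T" "N \<subseteq> kernel T E \<delta>"
    and ker: "kernel T E \<delta> \<subseteq> Z"
    and tf: "torsion_free (T\<lparr>carrier := Z\<rparr> Mod N)"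
  shows "left_orderable E \<Longrightarrow> left_orderable (T Mod N)"
    and "circularly_orderable E \<Longrightarrow> circularly_orderable (T Mod N)"
proof -
  interpret T: group T by fact
  have NZ: "N \<subseteq> Z" using N(2) ker by blast
  have comm: "z \<otimes>\<^bsub>T\<^esub> x = x \<otimes>\<^bsub>T\<^esub> z" if "z \<in> Z" "x \<in> carrier T" for z x
    using that Z(2) by (auto simp: center_def)
  have norm: "N \<lhd> T"
  proof (rule T.normalI[OF N(1)], rule ballI)
    fix x assume "x \<in> carrier T"
    then show "N #>\<^bsub>T\<^esub> x = x <#\<^bsub>T\<^esub> N"
      using comm NZ by (force simp: r_coset_def l_coset_def)
  qed
  interpret N: normal N T by fact
  let ?Q = "T Mod N"
  interpret Q: group ?Q by (rule N.factorgroup_is_group)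
  have \<delta>N: "\<delta> n = \<one>\<^bsub>E\<^esub>" if "n \<in> N" for n using that N(2) by (auto simp: kernel_def)
  interpret d: group_hom ?Q E "induced \<delta>"
    by (rule group_homI[OF Q.is_group E induced_coset_hom[OF norm E \<delta> \<delta>N]])
  let ?K = "kernel ?Q E (induced \<delta>)"
  have K: "\<exists>z\<in>Z. k = N #>\<^bsub>T\<^esub> z" if k: "k \<in> ?K" for k
  proof -
    obtain t where t: "t \<in> carrier T" "k = N #>\<^bsub>T\<^esub> t"
      using k by (auto simp: kernel_def FactGroup_def RCOSETS_def)
    then have "t \<in> kernel T E \<delta>"
      using k induced_coset[OF norm E \<delta> \<delta>N t(1)] by (simp add: kernel_def)
    then show ?thesis using ker t(2) by blast
  qed
  have Kcomm: "comm_group (?Q\<lparr>carrier := ?K\<rparr>)"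
  proof (rule group.group_comm_groupI)
    show "group (?Q\<lparr>carrier := ?K\<rparr>)"
      by (rule subgroup.subgroup_is_group[OF d.subgroup_kernel Q.is_group])
    fix k l assume "k \<in> carrier (?Q\<lparr>carrier := ?K\<rparr>)" "l \<in> carrier (?Q\<lparr>carrier := ?K\<rparr>)"
    then obtain z w where "z \<in> Z" "k = N #>\<^bsub>T\<^esub> z" "w \<in> Z" "l = N #>\<^bsub>T\<^esub> w"
      using K[of k] K[of l] by auto
    then show "k \<otimes>\<^bsub>?Q\<lparr>carrier := ?K\<rparr>\<^esub> l = l \<otimes>\<^bsub>?Q\<lparr>carrier := ?K\<rparr>\<^esub> k"
      using subgroup.mem_carrier[OF Z(1)] comm by (auto simp: FactGroup_def N.rcos_sum)
  qed
  have Ktf: "torsion_free (?Q\<lparr>carrier := ?K\<rparr>)"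
    unfolding torsion_free_def
  proof (intro ballI allI impI)
    fix k and n :: nat
    assume k: "k \<in> carrier (?Q\<lparr>carrier := ?K\<rparr>)"
      and n: "0 < n \<and> k [^]\<^bsub>?Q\<lparr>carrier := ?K\<rparr>\<^esub> n = \<one>\<^bsub>?Q\<lparr>carrier := ?K\<rparr>\<^esub>"
    let ?R = "T\<lparr>carrier := Z\<rparr> Mod N"
    have pow: "k [^]\<^bsub>?R\<^esub> n = k [^]\<^bsub>?Q\<lparr>carrier := ?K\<rparr>\<^esub> n" for n :: nat
      by (induction n) (simp_all add: FactGroup_def set_mult_def)
    have "k \<in> carrier ?R" using k K by (fastforce simp: FactGroup_def RCOSETS_def r_coset_def)
    moreover have "k [^]\<^bsub>?R\<^esub> n = \<one>\<^bsub>?R\<^esub>" using n unfolding pow by (simp add: FactGroup_def)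
    ultimately have "k = \<one>\<^bsub>?R\<^esub>" using tf n unfolding torsion_free_def by blast
    then show "k = \<one>\<^bsub>?Q\<lparr>carrier := ?K\<rparr>\<^esub>" by (simp add: FactGroup_def)
  qed
  note Kord = comm_group.torsion_free_left_orderable[OF Kcomm Ktf]
  show "left_orderable E \<Longrightarrow> left_orderable ?Q" by (rule d.left_orderable_extension[OF Kord])
  show "circularly_orderable E \<Longrightarrow> circularly_orderable ?Q"
    by (rule d.circularly_orderable_extension[OF Kord])
qed

section \<open>The crossed module structure of the tensor square\<close>

text \<open>Every element of the tensor square is a product of tensors and their inverses.\<close>

lemma tensor_square_induct [consumes 2, case_names one tensor mult inv]:
  assumes "group G" and "t \<in> carrier (tensor_square G)"
    and one: "P \<one>\<^bsub>tensor_square G\<^esub>"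
    and gen: "\<And>g h. g \<in> carrier G \<Longrightarrow> h \<in> carrier G \<Longrightarrow> P (tensor G g h)"
    and mult: "\<And>t u. t \<in> carrier (tensor_square G) \<Longrightarrow> u \<in> carrier (tensor_square G) \<Longrightarrow>
      P t \<Longrightarrow> P u \<Longrightarrow> P (t \<otimes>\<^bsub>tensor_square G\<^esub> u)"
    and inv: "\<And>t. t \<in> carrier (tensor_square G) \<Longrightarrow> P t \<Longrightarrow> P (inv\<^bsub>tensor_square G\<^esub> t)"
  shows "P t"
proof -
  let ?T = "tensor_square G" and ?X = "carrier G \<times> carrier G"
  let ?r = "pres_rel ?X (tensor_rels G)"
  interpret T: group ?T by (rule group_tensor_square)
  have T: "?T = presented_group ?X (tensor_rels G)" by (simp add: tensor_square_def)
  have letter: "P (?r `` {[(x, b)]})" if x: "x \<in> ?X" for x b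
  proof -
    obtain g h where gh: "x = (g, h)" by force
    have t: "?r `` {[(x, True)]} = tensor G g h" by (simp add: gh tensor_def)
    have c: "tensor G g h \<in> carrier ?T" using x gh by (simp add: tensor_closed)
    have w: "[(x, b)] \<in> words ?X" for b using x by (simp add: words_def)
    have "?r `` {[(x, False)]} \<otimes>\<^bsub>?T\<^esub> ?r `` {[(x, True)]} = ?r `` {[(x, False), (x, True)]}"
      using presented_mult[OF w w, where R="tensor_rels G"] by (simp add: T)
    also have "\<dots> = ?r `` {[]}"
      using pe_cancel[OF x, of "tensor_rels G" False]
      by (intro equiv_class_eq[OF equiv_pres_rel]) (simp add: pres_rel_def)
    finally have "?r `` {[(x, False)]} \<otimes>\<^bsub>?T\<^esub> tensor G g h = \<one>\<^bsub>?T\<^esub>"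
      by (simp add: t T presented_one)
    then have "?r `` {[(x, False)]} = inv\<^bsub>?T\<^esub> tensor G g h"
      by (rule T.inv_equality[symmetric]) (use c w in \<open>simp_all add: T presented_carrierI\<close>)
    then show ?thesis using t gen[of g h] inv[OF c] x gh by (cases b) auto
  qed
  obtain w where w: "w \<in> words ?X" "t = ?r `` {w}"
    using assms(2) unfolding T by (rule presented_carrierE)
  from w(1) have "P (?r `` {w})"
  proof (induction w)
    case Nil
    then show ?case using one by (simp add: T presented_one)
  next
    case (Cons l w)
    then have l: "[l] \<in> words ?X" and w: "w \<in> words ?X" by (auto simp: words_def)
    have "?r `` {l # w} = ?r `` {[l]} \<otimes>\<^bsub>?T\<^esub> ?r `` {w}"
      using presented_mult[OF l w, where R="tensor_rels G"] by (simp add: T)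
    moreover have "P (?r `` {[l]})" using letter[of "fst l" "snd l"] l by (auto simp: words_def)
    ultimately show ?case
      using mult Cons.IH[OF w] l w by (simp add: T presented_carrierI)
  qed
  then show ?thesis using w by simp
qed

lemma tensor_hom_eqI:
  assumes "group G" "group H" "\<phi> \<in> hom (tensor_square G) H" "\<psi> \<in> hom (tensor_square G) H"
    and eq: "\<And>g h. g \<in> carrier G \<Longrightarrow> h \<in> carrier G \<Longrightarrow> \<phi> (tensor G g h) = \<psi> (tensor G g h)"
    and t: "t \<in> carrier (tensor_square G)"
  shows "\<phi> t = \<psi> t"
proof -
  interpret a: group_hom "tensor_square G" H \<phi>
    by (rule group_homI[OF group_tensor_square assms(2,3)])
  interpret b: group_hom "tensor_square G" H \<psi>
    by (rule group_homI[OF group_tensor_square assms(2,4)])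
  from assms(1) t show ?thesis
    by (induction t rule: tensor_square_induct) (simp_all add: eq)
qed

lemma (in group) conj_act_closed: "x \<in> carrier G \<Longrightarrow> y \<in> carrier G \<Longrightarrow> conj_act G x y \<in> carrier G"
  by (simp add: conj_act_def)

lemma (in group) conj_act_mult:
  "x \<in> carrier G \<Longrightarrow> y \<in> carrier G \<Longrightarrow> z \<in> carrier G \<Longrightarrow>
    conj_act G (x \<otimes> y) z = conj_act G x (conj_act G y z)"
  "x \<in> carrier G \<Longrightarrow> y \<in> carrier G \<Longrightarrow> z \<in> carrier G \<Longrightarrow>
    conj_act G x (y \<otimes> z) = conj_act G x y \<otimes> conj_act G x z"
  by (simp_all add: conj_act_def m_assoc inv_mult_group) (simp flip: m_assoc)

lemma (in group) conj_act_one: "x \<in> carrier G \<Longrightarrow> conj_act G \<one> x = x"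
  by (simp add: conj_act_def)

text \<open>Expanding \<open>ga' \<otimes> hb'\<close> with the left relation first and with the right relation first gives
  two products with the same outer factors. Cancelling these leaves
  \<open>(\<^sup>g\<^sup>ha' \<otimes> \<^sup>g\<^sup>hb') (g \<otimes> h) = (g \<otimes> h) (\<^sup>h\<^sup>ga' \<otimes> \<^sup>h\<^sup>gb')\<close>, and it remains to choose \<open>a'\<close> and \<open>b'\<close> such
  that \<open>hg\<close> carries them to \<open>a\<close> and \<open>b\<close>.\<close>

lemma tensor_conj_tensor:
  fixes G (structure)
  assumes "group G" and c: "g \<in> carrier G" "h \<in> carrier G" "a \<in> carrier G" "b \<in> carrier G"
  shows "tensor G g h \<otimes>\<^bsub>tensor_square G\<^esub> tensor G a b =
    tensor G (conj_act G (commutator G g h) a) (conj_act G (commutator G g h) b)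
      \<otimes>\<^bsub>tensor_square G\<^esub> tensor G g h"
proof -
  interpret group G by fact
  interpret T: group "tensor_square G" by (rule group_tensor_square)
  note cl = conj_act_closed tensor_closed
  define a' b' where "a' = conj_act G (inv (h \<otimes> g)) a" and "b' = conj_act G (inv (h \<otimes> g)) b"
  have c': "a' \<in> carrier G" "b' \<in> carrier G" using c by (simp_all add: a'_def b'_def cl)
  let ?C = "conj_act G" and ?t = "tensor G"
  have sw: "?C (?C x y) (?C x z) = ?C x (?C y z)" if "x \<in> carrier G" "y \<in> carrier G" "z \<in> carrier G" for x y z
    using that by (simp add: conj_act_def m_assoc inv_mult_group) (simp flip: m_assoc)
  have 1: "?t (g \<otimes> a') (h \<otimes> b') = ?t (?C g a') (?C g h) \<otimes>\<^bsub>tensor_square G\<^esub>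
      (?t (?C g (?C h a')) (?C g (?C h b')) \<otimes>\<^bsub>tensor_square G\<^esub> (?t g h \<otimes>\<^bsub>tensor_square G\<^esub> ?t (?C h g) (?C h b')))"
  proof -
    have "?t (g \<otimes> a') (h \<otimes> b') = ?t (?C g a') (?C g (h \<otimes> b')) \<otimes>\<^bsub>tensor_square G\<^esub> ?t g (h \<otimes> b')"
      using c c' by (simp add: tensor_rel_left[OF assms(1)])
    also have "?t (?C g a') (?C g (h \<otimes> b')) =
        ?t (?C g a') (?C g h) \<otimes>\<^bsub>tensor_square G\<^esub> ?t (?C g (?C h a')) (?C g (?C h b'))"
      using c c' by (simp add: tensor_rel_right[OF assms(1)] conj_act_mult sw cl)
    finally show ?thesis using c c' by (simp add: tensor_rel_right[OF assms(1)] cl T.m_assoc)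
  qed
  have 2: "?t (g \<otimes> a') (h \<otimes> b') = ?t (?C g a') (?C g h) \<otimes>\<^bsub>tensor_square G\<^esub>
      (?t g h \<otimes>\<^bsub>tensor_square G\<^esub> (?t (?C h (?C g a')) (?C h (?C g b')) \<otimes>\<^bsub>tensor_square G\<^esub> ?t (?C h g) (?C h b')))"
  proof -
    have "?t (g \<otimes> a') (h \<otimes> b') = ?t (g \<otimes> a') h \<otimes>\<^bsub>tensor_square G\<^esub> ?t (?C h (g \<otimes> a')) (?C h b')"
      using c c' by (simp add: tensor_rel_right[OF assms(1)])
    also have "?t (?C h (g \<otimes> a')) (?C h b') =
        ?t (?C h (?C g a')) (?C h (?C g b')) \<otimes>\<^bsub>tensor_square G\<^esub> ?t (?C h g) (?C h b')"
      using c c' by (simp add: tensor_rel_left[OF assms(1)] conj_act_mult sw cl)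
    finally show ?thesis using c c' by (simp add: tensor_rel_left[OF assms(1)] cl T.m_assoc)
  qed
  have 3: "?t (?C g (?C h a')) (?C g (?C h b')) \<otimes>\<^bsub>tensor_square G\<^esub> ?t g h =
      ?t g h \<otimes>\<^bsub>tensor_square G\<^esub> ?t (?C h (?C g a')) (?C h (?C g b'))"
  proof -
    have "?t (?C g (?C h a')) (?C g (?C h b')) \<otimes>\<^bsub>tensor_square G\<^esub> ?t g h \<otimes>\<^bsub>tensor_square G\<^esub> ?t (?C h g) (?C h b') =
      ?t g h \<otimes>\<^bsub>tensor_square G\<^esub> ?t (?C h (?C g a')) (?C h (?C g b')) \<otimes>\<^bsub>tensor_square G\<^esub> ?t (?C h g) (?C h b')"
      using trans[OF 1[symmetric] 2] c c' by (simp add: cl T.m_assoc)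
    then show ?thesis using c c' by (simp add: cl)
  qed
  have undo: "?C h (?C g (?C (inv (h \<otimes> g)) x)) = x"
    and redo: "?C g (?C h (?C (inv (h \<otimes> g)) x)) = ?C (commutator G g h) x" if "x \<in> carrier G" for x
    using that c
    by (simp_all add: conj_act_one commutator_def inv_mult_group m_assoc flip: conj_act_mult(1))
       (simp add: conj_act_one flip: m_assoc)
  show ?thesis using 3 c by (simp add: a'_def b'_def undo redo)
qed

lemma (in group) intertwine_inv:
  assumes "t \<otimes> a = b \<otimes> t" "t \<in> carrier G" "a \<in> carrier G" "b \<in> carrier G"
  shows "inv t \<otimes> b = a \<otimes> inv t"
proof -
  have "inv t \<otimes> b = inv t \<otimes> (b \<otimes> t) \<otimes> inv t" using assms(2-4) by (simp add: m_assoc)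
  also have "\<dots> = inv t \<otimes> t \<otimes> a \<otimes> inv t"
    using assms(2-4) by (simp only: m_assoc assms(1)[symmetric] m_closed inv_closed)
  also have "\<dots> = a \<otimes> inv t" using assms(2-4) by simp
  finally show ?thesis .
qed

text \<open>The Peiffer identity of the crossed module \<open>G \<otimes> G \<rightarrow> G\<close>: an element acts on tensors by
  conjugation as its commutator image does. It passes from tensors to all elements because the \<open>t\<close>
  that satisfy it form a subgroup.\<close>

lemma tensor_conj:
  assumes G: "group G" and t: "t \<in> carrier (tensor_square G)" and c: "a \<in> carrier G" "b \<in> carrier G"
  shows "t \<otimes>\<^bsub>tensor_square G\<^esub> tensor G a b =
    tensor G (conj_act G (tensor_commutator G t) a) (conj_act G (tensor_commutator G t) b)
      \<otimes>\<^bsub>tensor_square G\<^esub> t"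
  using G t c
proof (induction t arbitrary: a b rule: tensor_square_induct)
  interpret G: group G by fact
  interpret T: group "tensor_square G" by (rule group_tensor_square)
  interpret d: group_hom "tensor_square G" G "tensor_commutator G"
    by (rule group_homI[OF T.is_group G tensor_commutator_hom(1)[OF G]])
  note cl = G.conj_act_closed tensor_closed
  {
    case one
    then show ?case by (simp add: G.conj_act_one cl)
  next
    case (tensor g h)
    then show ?case using tensor_conj_tensor[OF G] by (simp add: tensor_commutator_hom(2)[OF G])
  next
    case (mult t u)
    then show ?case by (simp add: G.conj_act_mult cl T.m_assoc) (simp add: cl flip: T.m_assoc)
  next
    case (inv t)
    let ?d = "inv\<^bsub>G\<^esub> (tensor_commutator G t)"
    have "t \<otimes>\<^bsub>tensor_square G\<^esub> tensor G (conj_act G ?d a) (conj_act G ?d b) =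
      tensor G a b \<otimes>\<^bsub>tensor_square G\<^esub> t"
      using inv by (simp add: cl G.conj_act_one flip: G.conj_act_mult(1))
    then show ?case using inv by (simp add: cl T.intertwine_inv)
  }
qed

lemma J2_central:
  assumes G: "group G"
  shows "J2 G \<subseteq> center (tensor_square G)"
proof
  interpret G: group G by fact
  interpret T: group "tensor_square G" by (rule group_tensor_square)
  fix z assume "z \<in> J2 G"
  then have z: "z \<in> carrier (tensor_square G)" "tensor_commutator G z = \<one>\<^bsub>G\<^esub>"
    by (auto simp: J2_def kernel_def)
  have "z \<otimes>\<^bsub>tensor_square G\<^esub> t = t \<otimes>\<^bsub>tensor_square G\<^esub> z" if "t \<in> carrier (tensor_square G)" for t
    using G that
  proof (induction t rule: tensor_square_induct)
    case (tensor g h)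
    then show ?case using tensor_conj[OF G z(1)] z by (simp add: G.conj_act_one)
  next
    case (mult t u)
    then show ?case using z by (metis T.m_assoc)
  next
    case (inv t)
    then show ?case using z by (metis T.intertwine_inv)
  qed (use z in auto)
  then show "z \<in> center (tensor_square G)" using z by (simp add: center_def)
qed

section \<open>Normal closures\<close>

lemma (in group) normal_closure_normal:
  assumes "S \<subseteq> carrier G"
  shows "normal_closure G S \<lhd> G"
  unfolding normal_inv_iff
proof (intro conjI ballI)
  have "carrier G \<lhd> G" by (simp add: normal_inv_iff subgroup_self)
  then show "subgroup (normal_closure G S) G"
    unfolding normal_closure_def
    by (intro subgroups_Inter) (use assms in \<open>auto dest: normal_imp_subgroup\<close>)
next
  fix x n assume "x \<in> carrier G" "n \<in> normal_closure G S"
  then show "x \<otimes> n \<otimes> inv x \<in> normal_closure G S"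
    by (auto simp: normal_closure_def normal_inv_iff)
qed

lemma (in group_hom) normal_closure_subset_kernel:
  assumes "S \<subseteq> kernel G H h" "n \<in> normal_closure G S"
  shows "h n = \<one>\<^bsub>H\<^esub>"
  using assms normal_kernel by (auto simp: normal_closure_def kernel_def)

section \<open>Commutators of lifts\<close>

lemma (in group) conj_act_center:
  "z \<in> center G \<Longrightarrow> x \<in> carrier G \<Longrightarrow> conj_act G z x = x"
  by (auto simp: conj_act_def center_def m_assoc)

text \<open>Elements with the same image differ by a central factor, which acts trivially by
  conjugation. The two entries are exchanged one after the other, using
  \<open>[x, y] = \<^sup>xy \<cdot> y\<inverse> = x \<cdot> (\<^sup>yx)\<inverse>\<close>.\<close>

lemma (in group_hom) commutator_cong:
  assumes ker: "kernel G H h \<subseteq> center G"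
    and c: "x \<in> carrier G" "x' \<in> carrier G" "y \<in> carrier G" "y' \<in> carrier G"
    and eq: "h x = h x'" "h y = h y'"
  shows "commutator G x y = commutator G x' y'"
proof -
  have z: "\<exists>z\<in>center G. b = z \<otimes>\<^bsub>G\<^esub> a" if "a \<in> carrier G" "b \<in> carrier G" "h a = h b" for a b
  proof
    show "b = b \<otimes>\<^bsub>G\<^esub> inv\<^bsub>G\<^esub> a \<otimes>\<^bsub>G\<^esub> a" using that by (simp add: G.m_assoc)
    show "b \<otimes>\<^bsub>G\<^esub> inv\<^bsub>G\<^esub> a \<in> center G"
      by (rule subsetD[OF ker]) (use that in \<open>simp add: kernel_def\<close>)
  qed
  have zc: "z \<in> carrier G" if "z \<in> center G" for z using that by (simp add: center_def)
  have conj: "conj_act G a w = conj_act G b w"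
    if "a \<in> carrier G" "b \<in> carrier G" "h a = h b" "w \<in> carrier G" for a b w
    using z[OF that(1-3)] zc that
    by (auto simp: G.conj_act_mult G.conj_act_center G.conj_act_closed)
  have "commutator G x y = conj_act G x y \<otimes>\<^bsub>G\<^esub> inv\<^bsub>G\<^esub> y" by (simp add: commutator_def conj_act_def)
  also have "\<dots> = conj_act G x' y \<otimes>\<^bsub>G\<^esub> inv\<^bsub>G\<^esub> y" using conj[OF c(1,2) eq(1)] c by simp
  also have "\<dots> = x' \<otimes>\<^bsub>G\<^esub> inv\<^bsub>G\<^esub> (conj_act G y x')"
    using c by (simp add: conj_act_def G.m_assoc G.inv_mult_group)
  also have "\<dots> = x' \<otimes>\<^bsub>G\<^esub> inv\<^bsub>G\<^esub> (conj_act G y' x')" using conj[OF c(3,4) eq(2)] c by simp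
  also have "\<dots> = commutator G x' y'"
    using c by (simp add: commutator_def conj_act_def G.m_assoc G.inv_mult_group)
  finally show ?thesis .
qed

text \<open>The commutator pairing of lifts satisfies the relations of the tensor square because
  commutators in \<open>E\<close> do; the latter is read off from the commutator map on the tensor square of \<open>E\<close>.\<close>

lemma central_extension_commutator_hom:
  assumes E: "group E" and G: "group G" and p: "p \<in> epi E G" and ker: "kernel E G p \<subseteq> center E"
  obtains \<delta> where "\<delta> \<in> hom (tensor_square G) E"
    "\<And>x y. x \<in> carrier E \<Longrightarrow> y \<in> carrier E \<Longrightarrow> \<delta> (tensor G (p x) (p y)) = commutator E x y"
    "\<And>t. t \<in> carrier (tensor_square G) \<Longrightarrow> p (\<delta> t) = tensor_commutator G t"
proof -
  interpret p: group_hom E G p by (rule group_homI[OF E G]) (use p in \<open>simp add: epi_def\<close>)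
  define s where "s = inv_into (carrier E) p"
  have s: "s g \<in> carrier E" "p (s g) = g" if "g \<in> carrier G" for g
    using that p by (auto simp: s_def epi_def intro: inv_into_into f_inv_into_f)
  have surj: "\<exists>x\<in>carrier E. g = p x" if "g \<in> carrier G" for g using s that by metis
  define \<beta> where "\<beta> g h = commutator E (s g) (s h)" for g h
  have \<beta>: "\<beta> (p x) (p y) = commutator E x y" if "x \<in> carrier E" "y \<in> carrier E" for x y
    unfolding \<beta>_def using that s by (intro p.commutator_cong[OF ker]) auto
  have conj: "conj_act G (p x) (p y) = p (conj_act E x y)" if "x \<in> carrier E" "y \<in> carrier E" for x y
    using that by (simp add: conj_act_def)
  interpret tc: group_hom "tensor_square E" E "tensor_commutator E"
    by (rule group_homI[OF group_tensor_square E tensor_commutator_hom(1)[OF E]])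
  have cl: "\<beta> g h \<in> carrier E" if "g \<in> carrier G" "h \<in> carrier G" for g h
    using that s by (simp add: \<beta>_def commutator_def)
  have l: "\<beta> (g \<otimes>\<^bsub>G\<^esub> g') h = \<beta> (conj_act G g g') (conj_act G g h) \<otimes>\<^bsub>E\<^esub> \<beta> g h"
    if c: "g \<in> carrier G" "g' \<in> carrier G" "h \<in> carrier G" for g g' h
  proof -
    obtain x y z where x: "x \<in> carrier E" "y \<in> carrier E" "z \<in> carrier E" and
      eq: "g = p x" "g' = p y" "h = p z" using c surj by metis
    have "commutator E (x \<otimes>\<^bsub>E\<^esub> y) z =
        commutator E (conj_act E x y) (conj_act E x z) \<otimes>\<^bsub>E\<^esub> commutator E x z"
      using arg_cong[OF tensor_rel_left[OF E x], of "tensor_commutator E"] x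
      by (simp add: tensor_commutator_hom(2)[OF E] tensor_closed p.G.conj_act_closed)
    then show ?thesis
      using x by (simp add: eq conj \<beta> p.G.conj_act_closed flip: p.hom_mult)
  qed
  have r: "\<beta> g (h \<otimes>\<^bsub>G\<^esub> h') = \<beta> g h \<otimes>\<^bsub>E\<^esub> \<beta> (conj_act G h g) (conj_act G h h')"
    if c: "g \<in> carrier G" "h \<in> carrier G" "h' \<in> carrier G" for g h h'
  proof -
    obtain x y z where x: "x \<in> carrier E" "y \<in> carrier E" "z \<in> carrier E" and
      eq: "g = p x" "h = p y" "h' = p z" using c surj by metis
    have "commutator E x (y \<otimes>\<^bsub>E\<^esub> z) =
        commutator E x y \<otimes>\<^bsub>E\<^esub> commutator E (conj_act E y x) (conj_act E y z)"
      using arg_cong[OF tensor_rel_right[OF E x], of "tensor_commutator E"] x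
      by (simp add: tensor_commutator_hom(2)[OF E] tensor_closed p.G.conj_act_closed)
    then show ?thesis
      using x by (simp add: eq conj \<beta> p.G.conj_act_closed flip: p.hom_mult)
  qed
  let ?d = "induced (word_eval E (\<lambda>(g, h). \<beta> g h))"
  note u = tensor_universal[OF G E, of \<beta>, OF cl l r]
  show ?thesis
  proof
    show "?d \<in> hom (tensor_square G) E" by (rule u(1))
    show "?d (tensor G (p x) (p y)) = commutator E x y" if "x \<in> carrier E" "y \<in> carrier E" for x y
      using u(2) \<beta> that by simp
    show "p (?d t) = tensor_commutator G t" if "t \<in> carrier (tensor_square G)" for t
    proof -
      have "(p \<circ> ?d) t = tensor_commutator G t"
      proof (rule tensor_hom_eqI[OF G G _ tensor_commutator_hom(1)[OF G] _ that])
        show "p \<circ> ?d \<in> hom (tensor_square G) G" by (rule hom_compose[OF u(1) p.homh])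
        show "(p \<circ> ?d) (tensor G g h) = tensor_commutator G (tensor G g h)"
          if "g \<in> carrier G" "h \<in> carrier G" for g h
          using that s u(2)[of g h] by (simp add: \<beta>_def tensor_commutator_hom(2)[OF G]) (simp add: commutator_def)
      qed
      then show ?thesis by simp
    qed
  qed
qed

section \<open>Orderability of relative quotients\<close>

text \<open>The common form of both cases. \<open>S\<close> and \<open>T\<close> stand for the tensor (or exterior) squares of \<open>\<Gamma>\<close>
  and \<open>G\<close>, \<open>d\<^sub>S\<close> and \<open>d\<^sub>T\<close> for their commutator maps, \<open>m\<close> for the map that \<open>f\<close> induces between them,
  \<open>f'\<close> for the lift of \<open>f\<close>, and \<open>\<delta>\<close> for the commutator map of lifts.\<close>

lemma orderable_relative_quotient:
  assumes grp: "group S" "group T" "group \<Gamma>" "group G" "group E"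
    and d: "d\<^sub>S \<in> hom S \<Gamma>" "d\<^sub>T \<in> hom T G" and m: "m \<in> hom S T"
    and p: "p \<in> hom E G" and f': "f' \<in> hom \<Gamma> E" and \<delta>: "\<delta> \<in> hom T E"
    and p\<delta>: "\<And>t. t \<in> carrier T \<Longrightarrow> p (\<delta> t) = d\<^sub>T t"
    and \<delta>m: "\<And>s. s \<in> carrier S \<Longrightarrow> \<delta> (m s) = f' (d\<^sub>S s)"
    and central: "kernel T G d\<^sub>T \<subseteq> center T"
    and tf: "torsion_free (T\<lparr>carrier := kernel T G d\<^sub>T\<rparr> Mod m ` kernel S \<Gamma> d\<^sub>S)"
  shows "left_orderable E \<Longrightarrow> left_orderable (T Mod m ` kernel S \<Gamma> d\<^sub>S)"
    and "circularly_orderable E \<Longrightarrow> circularly_orderable (T Mod m ` kernel S \<Gamma> d\<^sub>S)"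
proof -
  interpret dS: group_hom S \<Gamma> d\<^sub>S by (rule group_homI[OF grp(1,3) d(1)])
  interpret dT: group_hom T G d\<^sub>T by (rule group_homI[OF grp(2,4) d(2)])
  interpret m: group_hom S T m by (rule group_homI[OF grp(1,2) m])
  interpret p: group_hom E G p by (rule group_homI[OF grp(5,4) p])
  interpret f': group_hom \<Gamma> E f' by (rule group_homI[OF grp(3,5) f'])
  have N: "subgroup (m ` kernel S \<Gamma> d\<^sub>S) T"
    by (rule m.subgroup_img_is_subgroup[OF dS.subgroup_kernel])
  have "m ` kernel S \<Gamma> d\<^sub>S \<subseteq> kernel T E \<delta>" by (auto simp: kernel_def \<delta>m)
  moreover have "kernel T E \<delta> \<subseteq> kernel T G d\<^sub>T" by (auto simp: kernel_def simp flip: p\<delta>)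
  ultimately show "left_orderable E \<Longrightarrow> left_orderable (T Mod m ` kernel S \<Gamma> d\<^sub>S)"
    "circularly_orderable E \<Longrightarrow> circularly_orderable (T Mod m ` kernel S \<Gamma> d\<^sub>S)"
    using orderable_central_quotient[OF grp(2,5) \<delta> dT.subgroup_kernel central N _ _ tf] by auto
qed

section \<open>The exterior square\<close>

lemma exterior_square_facts:
  assumes G: "group G"
  shows diagonal_closure_normal: "diagonal_closure G \<lhd> tensor_square G"
    and group_exterior_square: "group (exterior_square G)"
    and exterior_carrier_coset: "u \<in> carrier (exterior_square G) \<Longrightarrow>
      \<exists>t\<in>carrier (tensor_square G). u = diagonal_closure G #>\<^bsub>tensor_square G\<^esub> t"
    and diagonal_closure_trivial: "h \<in> hom (tensor_square G) H \<Longrightarrow> group H \<Longrightarrow>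
      (\<And>g. g \<in> carrier G \<Longrightarrow> h (tensor G g g) = \<one>\<^bsub>H\<^esub>) \<Longrightarrow> n \<in> diagonal_closure G \<Longrightarrow> h n = \<one>\<^bsub>H\<^esub>"
proof -
  interpret T: group "tensor_square G" by (rule group_tensor_square)
  show D: "diagonal_closure G \<lhd> tensor_square G"
    unfolding diagonal_closure_def by (rule T.normal_closure_normal) (auto simp: tensor_closed)
  show "group (exterior_square G)"
    unfolding exterior_square_def by (rule normal.factorgroup_is_group[OF D])
  show "u \<in> carrier (exterior_square G) \<Longrightarrow>
      \<exists>t\<in>carrier (tensor_square G). u = diagonal_closure G #>\<^bsub>tensor_square G\<^esub> t"
    by (auto simp: exterior_square_def FactGroup_def RCOSETS_def)
  assume h: "h \<in> hom (tensor_square G) H" "group H"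
    and diag: "\<And>g. g \<in> carrier G \<Longrightarrow> h (tensor G g g) = \<one>\<^bsub>H\<^esub>" and n: "n \<in> diagonal_closure G"
  interpret h: group_hom "tensor_square G" H h by (rule group_homI[OF T.is_group h(2,1)])
  show "h n = \<one>\<^bsub>H\<^esub>"
    by (rule h.normal_closure_subset_kernel[OF _ n[unfolded diagonal_closure_def]])
      (auto simp: kernel_def diag tensor_closed)
qed

lemma exterior_commutator_hom:
  assumes G: "group G"
  shows "exterior_commutator G \<in> hom (exterior_square G) G"
    and "t \<in> carrier (tensor_square G) \<Longrightarrow>
      exterior_commutator G (diagonal_closure G #>\<^bsub>tensor_square G\<^esub> t) = tensor_commutator G t"
proof -
  interpret G: group G by fact
  note h = tensor_commutator_hom(1)[OF G]
  have D: "tensor_commutator G n = \<one>\<^bsub>G\<^esub>" if "n \<in> diagonal_closure G" for n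
    by (rule diagonal_closure_trivial[OF G h G _ that])
      (simp add: tensor_commutator_hom(2)[OF G] commutator_def G.m_assoc)
  note N = diagonal_closure_normal[OF G]
  show "exterior_commutator G \<in> hom (exterior_square G) G"
    unfolding exterior_commutator_def exterior_square_def by (rule induced_coset_hom[OF N G h D])
  show "t \<in> carrier (tensor_square G) \<Longrightarrow>
      exterior_commutator G (diagonal_closure G #>\<^bsub>tensor_square G\<^esub> t) = tensor_commutator G t"
    unfolding exterior_commutator_def by (rule induced_coset[OF N G h D])
qed

lemma exterior_map_hom:
  assumes \<Gamma>: "group \<Gamma>" and G: "group G" and f: "f \<in> hom \<Gamma> G"
  shows "exterior_map G f \<in> hom (exterior_square \<Gamma>) (exterior_square G)"
    and "t \<in> carrier (tensor_square \<Gamma>) \<Longrightarrow>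
      exterior_map G f (diagonal_closure \<Gamma> #>\<^bsub>tensor_square \<Gamma>\<^esub> t) =
      diagonal_closure G #>\<^bsub>tensor_square G\<^esub> tensor_map G f t"
proof -
  interpret D: normal "diagonal_closure G" "tensor_square G" by (rule diagonal_closure_normal[OF G])
  let ?h = "\<lambda>t. diagonal_closure G #>\<^bsub>tensor_square G\<^esub> tensor_map G f t"
  note E = group_exterior_square[OF G]
  have "(\<lambda>t. diagonal_closure G #>\<^bsub>tensor_square G\<^esub> t) \<circ> tensor_map G f \<in>
      hom (tensor_square \<Gamma>) (tensor_square G Mod diagonal_closure G)"
    by (rule hom_compose[OF tensor_map_hom(1)[OF \<Gamma> G f] D.r_coset_hom_Mod])
  then have h: "?h \<in> hom (tensor_square \<Gamma>) (exterior_square G)"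
    by (simp add: exterior_square_def comp_def)
  have d: "tensor G g g \<in> diagonal_closure G" if "g \<in> carrier G" for g
    using that by (auto simp: diagonal_closure_def normal_closure_def)
  have triv: "?h n = \<one>\<^bsub>exterior_square G\<^esub>" if "n \<in> diagonal_closure \<Gamma>" for n
  proof (rule diagonal_closure_trivial[OF \<Gamma> h E _ that])
    fix g assume g: "g \<in> carrier \<Gamma>"
    then have "?h (tensor \<Gamma> g g) = diagonal_closure G"
      using d[of "f g"] hom_in_carrier[OF f g]
      by (simp add: tensor_map_hom(2)[OF \<Gamma> G f] D.rcos_const)
    then show "?h (tensor \<Gamma> g g) = \<one>\<^bsub>exterior_square G\<^esub>"
      by (simp add: exterior_square_def FactGroup_def)
  qed
  note N = diagonal_closure_normal[OF \<Gamma>]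
  show "exterior_map G f \<in> hom (exterior_square \<Gamma>) (exterior_square G)"
    unfolding exterior_map_def exterior_square_def[of \<Gamma>] by (rule induced_coset_hom[OF N E h triv])
  show "t \<in> carrier (tensor_square \<Gamma>) \<Longrightarrow>
      exterior_map G f (diagonal_closure \<Gamma> #>\<^bsub>tensor_square \<Gamma>\<^esub> t) = ?h t"
    unfolding exterior_map_def by (rule induced_coset[OF N E h triv])
qed

text \<open>An element of this kernel is the class of an element of \<open>J\<^sub>2(G)\<close>, which is already central in
  the tensor square.\<close>

lemma exterior_kernel_central:
  assumes G: "group G"
  shows "kernel (exterior_square G) G (exterior_commutator G) \<subseteq> center (exterior_square G)"
proof
  interpret D: normal "diagonal_closure G" "tensor_square G" by (rule diagonal_closure_normal[OF G])
  let ?q = "\<lambda>t. diagonal_closure G #>\<^bsub>tensor_square G\<^esub> t"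
  have q: "?q s \<otimes>\<^bsub>exterior_square G\<^esub> ?q t = ?q (s \<otimes>\<^bsub>tensor_square G\<^esub> t)"
    if "s \<in> carrier (tensor_square G)" "t \<in> carrier (tensor_square G)" for s t
    using that by (simp add: exterior_square_def FactGroup_def D.rcos_sum)
  fix u assume u: "u \<in> kernel (exterior_square G) G (exterior_commutator G)"
  then obtain z where z: "z \<in> carrier (tensor_square G)" "u = ?q z"
    using exterior_carrier_coset[OF G] unfolding kernel_def by blast
  then have "z \<in> J2 G"
    using u by (simp add: kernel_def J2_def exterior_commutator_hom(2)[OF G])
  then have zc: "z \<otimes>\<^bsub>tensor_square G\<^esub> t = t \<otimes>\<^bsub>tensor_square G\<^esub> z"
    if "t \<in> carrier (tensor_square G)" for t
    using J2_central[OF G] that unfolding center_def by blast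
  have "u \<otimes>\<^bsub>exterior_square G\<^esub> v = v \<otimes>\<^bsub>exterior_square G\<^esub> u"
    if v: "v \<in> carrier (exterior_square G)" for v
    using exterior_carrier_coset[OF G v] z zc by (auto simp: q)
  then show "u \<in> center (exterior_square G)" using u by (simp add: center_def kernel_def)
qed

section \<open>Relative tensor and exterior squares\<close>

theorem theorem7p2:
  fixes \<Gamma> :: "('c, 'l) monoid_scheme" and G :: "('a, 'm) monoid_scheme"
    and E :: "('b, 'n) monoid_scheme"
    and f :: "'c \<Rightarrow> 'a" and p :: "'b \<Rightarrow> 'a"
  assumes "group \<Gamma>" and "group G" and "f \<in> hom \<Gamma> G"
    and "central_f_extension \<Gamma> G f E p"
  shows "(torsion_free (H2_quotient \<Gamma> G f) \<longrightarrow>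
            (left_orderable E \<longrightarrow> left_orderable (rel_exterior_square \<Gamma> G f)) \<and>
            (circularly_orderable E \<longrightarrow> circularly_orderable (rel_exterior_square \<Gamma> G f))) \<and>
         (torsion_free (J2_quotient \<Gamma> G f) \<longrightarrow>
            (left_orderable E \<longrightarrow> left_orderable (rel_tensor_square \<Gamma> G f)) \<and>
            (circularly_orderable E \<longrightarrow> circularly_orderable (rel_tensor_square \<Gamma> G f)))"
proof -
  note \<Gamma> = assms(1) and G = assms(2) and f = assms(3)
  have E: "group E" and p: "p \<in> epi E G" and ker: "kernel E G p \<subseteq> center E"
    using assms(4) by (auto simp: central_f_extension_def f_extension_def)
  obtain f' where f': "f' \<in> hom \<Gamma> E" and pf': "\<And>x. x \<in> carrier \<Gamma> \<Longrightarrow> p (f' x) = f x"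
    using assms(4) by (auto simp: central_f_extension_def f_extension_def)
  interpret E: group E by (rule E)
  interpret f': group_hom \<Gamma> E f' by (rule group_homI[OF \<Gamma> E f'])
  have ph: "p \<in> hom E G" using p by (simp add: epi_def)
  obtain \<delta> where \<delta>: "\<delta> \<in> hom (tensor_square G) E"
    and \<delta>t: "\<And>x y. x \<in> carrier E \<Longrightarrow> y \<in> carrier E \<Longrightarrow> \<delta> (tensor G (p x) (p y)) = commutator E x y"
    and p\<delta>: "\<And>t. t \<in> carrier (tensor_square G) \<Longrightarrow> p (\<delta> t) = tensor_commutator G t"
    using central_extension_commutator_hom[OF E G p ker] by blast
  have \<delta>m: "\<delta> (tensor_map G f t) = f' (tensor_commutator \<Gamma> t)"
    if "t \<in> carrier (tensor_square \<Gamma>)" for t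
  proof -
    have "(\<delta> \<circ> tensor_map G f) t = (f' \<circ> tensor_commutator \<Gamma>) t"
    proof (rule tensor_hom_eqI[OF \<Gamma> E hom_compose[OF tensor_map_hom(1)[OF \<Gamma> G f] \<delta>]
          hom_compose[OF tensor_commutator_hom(1)[OF \<Gamma>] f'] _ that])
      show "(\<delta> \<circ> tensor_map G f) (tensor \<Gamma> g h) = (f' \<circ> tensor_commutator \<Gamma>) (tensor \<Gamma> g h)"
        if "g \<in> carrier \<Gamma>" "h \<in> carrier \<Gamma>" for g h
        using that \<delta>t[of "f' g" "f' h"]
        by (simp add: tensor_map_hom(2)[OF \<Gamma> G f] tensor_commutator_hom(2)[OF \<Gamma>] pf' commutator_def)
    qed
    then show ?thesis by simp
  qed
  (* The kernels into the commutator subgroup and into the whole group are the same set. *)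
  have J2: "J2 G = kernel (tensor_square G) G (tensor_commutator G)"
    "J2 \<Gamma> = kernel (tensor_square \<Gamma>) \<Gamma> (tensor_commutator \<Gamma>)"
    by (simp_all add: J2_def kernel_def)
  have H2: "H2 G = kernel (exterior_square G) G (exterior_commutator G)"
    "H2 \<Gamma> = kernel (exterior_square \<Gamma>) \<Gamma> (exterior_commutator \<Gamma>)"
    by (simp_all add: H2_def kernel_def)
  note tensor = orderable_relative_quotient[OF group_tensor_square group_tensor_square \<Gamma> G E
      tensor_commutator_hom(1)[OF \<Gamma>] tensor_commutator_hom(1)[OF G] tensor_map_hom(1)[OF \<Gamma> G f]
      ph f' \<delta> p\<delta> \<delta>m J2_central[OF G, unfolded J2]]
  have \<delta>D: "\<delta> n = \<one>\<^bsub>E\<^esub>" if "n \<in> diagonal_closure G" for n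
  proof (rule diagonal_closure_trivial[OF G \<delta> E _ that])
    fix g assume "g \<in> carrier G"
    then obtain x where "x \<in> carrier E" "g = p x" using p by (auto simp: epi_def)
    then show "\<delta> (tensor G g g) = \<one>\<^bsub>E\<^esub>" by (simp add: \<delta>t commutator_def E.m_assoc)
  qed
  note D = diagonal_closure_normal[OF G]
  have \<delta>': "induced \<delta> \<in> hom (exterior_square G) E"
    unfolding exterior_square_def by (rule induced_coset_hom[OF D E \<delta> \<delta>D])
  note \<delta>'c = induced_coset[OF D E \<delta> \<delta>D]
  have p\<delta>': "p (induced \<delta> u) = exterior_commutator G u" if "u \<in> carrier (exterior_square G)" for u
    using exterior_carrier_coset[OF G that] by (auto simp: \<delta>'c p\<delta> exterior_commutator_hom(2)[OF G])
  have \<delta>m': "induced \<delta> (exterior_map G f u) = f' (exterior_commutator \<Gamma> u)"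
    if "u \<in> carrier (exterior_square \<Gamma>)" for u
    using exterior_carrier_coset[OF \<Gamma> that] hom_in_carrier[OF tensor_map_hom(1)[OF \<Gamma> G f]]
    by (auto simp: \<delta>'c \<delta>m exterior_map_hom(2)[OF \<Gamma> G f] exterior_commutator_hom(2)[OF \<Gamma>])
  note exterior = orderable_relative_quotient[OF group_exterior_square[OF \<Gamma>] group_exterior_square[OF G]
      \<Gamma> G E exterior_commutator_hom(1)[OF \<Gamma>] exterior_commutator_hom(1)[OF G]
      exterior_map_hom(1)[OF \<Gamma> G f] ph f' \<delta>' p\<delta>' \<delta>m' exterior_kernel_central[OF G]]
  show ?thesis
    using tensor exterior
    unfolding H2_quotient_def J2_quotient_def rel_exterior_square_def rel_tensor_square_def
      H2_image_def J2_image_def H2 J2 by blast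
qed

end
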